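(* Given $u\in\mathfrak{S}$, for any $\kappa\ge0$ introduce the function $$W_\kappa(r,u)=\frac{1}{r^{n-2+2\kappa}}\int_{B_r}|\nabla u|^2-\frac{\kappa}{r^{n-1+2\kappa}}\int_{\partial B_r}u^2 .$$ For $0<r<1$ one has $$\frac{d}{dr}W_\kappa(r,u)=\frac{2}{r^{n+2\kappa}}\int_{\partial B_r}(x\cdot\nabla u-\kappa u)^2 .$$ As a consequence, $r\mapsto W_\kappa(r,u)$ is nondecreasing on $(0,1)$. Furthermore, $W_\kappa(\cdot,u)$ is constant if and only if $u$ is homogeneous of degree $\kappa$.
   Context: Notation: $n\ge 2$, $x=(x',x_n)\in\mathbb{R}^{n-1}\times\mathbb{R}$; $B_r$ is the open ball of radius $r$ about $0$ in $\mathbb{R}^n$; $B_1^+=B_1\cap\{x_n>0\}$; $B_1'=B_1\cap(\mathbb{R}^{n-1}\times\{0\})$. On $\{x_n=0\}$, $\partial_{x_n}u$ always denotes the limit from inside $\{x_n>0\}$. Class $\mathfrak{S}$ (normalized solutions of the Signorini problem with zero obstacle): $u\in C^{1,\alpha}_{\mathrm{loc}}(B_1^+\cup B_1')$ for some $\alpha\in(0,1)$, with $\Delta u=0$ in $B_1^+$; $u\ge0$, $-\partial_{x_n}u\ge0$, $u\,\partial_{x_n}u=0$ on $B_1'$; and $0\in\Gamma(u)$, where $\Lambda(u)=\{(x',0)\in B_1': u(x',0)=0\}$ and $\Gamma(u)$ is the boundary of $\Lambda(u)$ in the relative topology of $B_1'$. Every $u\in\mathfrak{S}$ is extended to $B_1$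 by $u(x',-x_n)=u(x',x_n)$. Homogeneous of degree $\kappa$ means $x\cdot\nabla u-\kappa u=0$ in $B_1$. *)

theory Defs
  imports "HOL-Analysis.Analysis"
begin

definition pderiv_dir :: "'a::euclidean_space \<Rightarrow> ('a \<Rightarrow> real) \<Rightarrow> 'a \<Rightarrow> real" where
  "pderiv_dir b f x = frechet_derivative f (at x) b"

definition C2_on :: "('a::euclidean_space \<Rightarrow> real) \<Rightarrow> 'a set \<Rightarrow> bool" where
  "C2_on f S \<longleftrightarrow>
     (\<forall>x\<in>S. f differentiable at x) \<and>
     (\<forall>b\<in>Basis. \<forall>x\<in>S. pderiv_dir b f differentiable at x) \<and>
     (\<forall>b\<in>Basis. \<forall>c\<in>Basis. continuous_on S (pderiv_dir c (pderiv_dir b f)))"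

definition laplacian :: "('a::euclidean_space \<Rightarrow> real) \<Rightarrow> 'a \<Rightarrow> real" where
  "laplacian f x = (\<Sum>b\<in>Basis. pderiv_dir b (pderiv_dir b f) x)"

definition gradient :: "('a::euclidean_space \<Rightarrow> real) \<Rightarrow> 'a \<Rightarrow> 'a" where
  "gradient f x = (\<Sum>b\<in>Basis. pderiv_dir b f x *\<^sub>R b)"

text \<open>
  The surface measure on the sphere of radius r > 0 about the origin, as in the construction of
  polar coordinates: a Borel set A of the sphere has measure DIM('a) / r times the Lebesgue
  measure of the open cone {t x | x in A, 0 < t < 1} over A, which is the preimage of A in the
  ball under the radial projection. The total mass is DIM('a) / r times the volume of the ball.
  (The origin, where the projection below takes the value 0, is a null set.)
\<close>

definition sphere_measure :: "real \<Rightarrow> 'a::euclidean_space measure" where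
  "sphere_measure r =
     scale_measure (ennreal (real DIM('a) / r))
       (distr (restrict_space lborel (ball 0 r)) borel (\<lambda>x. (r / norm x) *\<^sub>R x))"

text \<open>
  The product type \<open>(real ^ 'm) \<times> real\<close>, with its Euclidean inner product and norm, plays the role
  of \<open>n\<close>-dimensional space, where n = CARD('m) + 1 is an arbitrary integer at least 2; the second
  component is the last coordinate.
\<close>

definition upper_ball :: "((real ^ 'm) \<times> real) set" where
  "upper_ball = ball 0 1 \<inter> {x. snd x > 0}"

definition flat_ball :: "((real ^ 'm) \<times> real) set" where
  "flat_ball = ball 0 1 \<inter> {x. snd x = 0}"

text \<open>The gradient, taken as the limit from the upper half-space where the last coordinate is 0.\<close>

definition grad :: "((real ^ 'm) \<times> real \<Rightarrow> real) \<Rightarrow> (real ^ 'm) \<times> real \<Rightarrow> (real ^ 'm) \<times> real" where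
  "grad u x =
     (if snd x = 0 then Lim (at x within {y. snd y > 0}) (gradient u) else gradient u x)"

definition C1_holder_loc :: "real \<Rightarrow> ((real ^ 'm) \<times> real \<Rightarrow> real) \<Rightarrow> bool" where
  "C1_holder_loc \<alpha> u \<longleftrightarrow>
     continuous_on (upper_ball \<union> flat_ball) u \<and>
     (\<forall>x\<in>upper_ball. u differentiable at x) \<and>
     (\<exists>G. (\<forall>x\<in>upper_ball. G x = gradient u x) \<and>
        (\<forall>K. compact K \<and> K \<subseteq> upper_ball \<union> flat_ball \<longrightarrow>
           (\<exists>C. \<forall>x\<in>K. \<forall>y\<in>K. norm (G x - G y) \<le> C * dist x y powr \<alpha>)))"

definition contact_set :: "((real ^ 'm) \<times> real \<Rightarrow> real) \<Rightarrow> ((real ^ 'm) \<times> real) set" where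
  "contact_set u = {x \<in> flat_ball. u x = 0}"

definition free_boundary :: "((real ^ 'm) \<times> real \<Rightarrow> real) \<Rightarrow> ((real ^ 'm) \<times> real) set" where
  "free_boundary u = top_of_set flat_ball frontier_of contact_set u"

text \<open>
  Normalized solutions of the Signorini problem with zero obstacle, already extended evenly to
  the unit ball (last condition). The values outside the unit ball are irrelevant.
\<close>

definition signorini :: "((real ^ 'm) \<times> real \<Rightarrow> real) set" where
  "signorini = {u.
     (\<exists>\<alpha>. 0 < \<alpha> \<and> \<alpha> < 1 \<and> C1_holder_loc \<alpha> u) \<and>
     C2_on u upper_ball \<and> (\<forall>x\<in>upper_ball. laplacian u x = 0) \<and>
     (\<forall>x\<in>flat_ball. u x \<ge> 0 \<and> - snd (grad u x) \<ge> 0 \<and> u x * snd (grad u x) = 0) \<and>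
     0 \<in> free_boundary u \<and>
     (\<forall>x\<in>ball 0 1. u (fst x, - snd x) = u x)}"

definition homogeneous :: "real \<Rightarrow> ((real ^ 'm) \<times> real \<Rightarrow> real) \<Rightarrow> bool" where
  "homogeneous \<kappa> u \<longleftrightarrow> (\<forall>x\<in>ball 0 1. x \<bullet> grad u x - \<kappa> * u x = 0)"

definition weiss :: "real \<Rightarrow> real \<Rightarrow> ((real ^ 'm) \<times> real \<Rightarrow> real) \<Rightarrow> real" where
  "weiss \<kappa> r u = (let n = real DIM((real ^ 'm) \<times> real) in
     1 / r powr (n - 2 + 2 * \<kappa>) * (LINT x:ball 0 r|lborel. (norm (grad u x))\<^sup>2)
     - \<kappa> / r powr (n - 1 + 2 * \<kappa>) * (LINT x:sphere 0 r|sphere_measure r. (u x)\<^sup>2))"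

end

theory Submission
  imports Defs
begin

text \<open>
  Write \<open>D\<close> and \<open>H\<close> for the integrals of \<open>|\<nabla>u|\<^sup>2\<close> over the ball and of \<open>u\<^sup>2\<close> over the sphere of radius
  \<open>r\<close>. The divergence theorem for the fields \<open>u \<nabla>u\<close>, \<open>|\<nabla>u|\<^sup>2 x - 2 (x \<bullet> \<nabla>u) \<nabla>u\<close> and \<open>u\<^sup>2 x\<close> expresses \<open>D\<close>,
  \<open>D'\<close> and \<open>H'\<close> by sphere integrals of \<open>(x \<bullet> \<nabla>u)\<^sup>2\<close>, \<open>u (x \<bullet> \<nabla>u)\<close> and \<open>u\<^sup>2\<close>, which combine to a square.
  The flat part contributes nothing: \<open>u\<close> times the normal derivative vanishes there, and where
  \<open>u = 0\<close> so do the tangential derivatives. Second derivatives need not be integrable up to the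
  flat part, but the divergences of the three fields extend continuously to it, so cutting off at height \<open>\<epsilon>\<close>
  and letting \<open>\<epsilon>\<close> tend to 0 is enough.
\<close>

section \<open>Derivative of ball integrals\<close>

text \<open>The half ball has an edge where sphere and flat part meet, and second derivatives of
  \<open>u\<close> are controlled only on compact subsets of the open half ball. So the one
  integration by parts is the vanishing of the integral of a directional derivative of a compactly
  supported function. A height cutoff keeps the support off the flat part. Towards the sphere the
  weight \<open>(max 0 (r\<^sup>2 - x \<bullet> x))\<^sup>2\<close> permits extension by 0; it is
  squared because the plain positive part is not differentiable there. Removing it again takes only
  derivatives of ball integrals in the radius, with continuous integrands. Sphere integrals are
  never differentiated directly: the field \<open>u\<^sup>2 x\<close> turns H(r) into 1/r times a
  ball integral, so both terms of the Weiss energy become powers of \<open>r\<close> times ball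
  integrals. The identities hold on the upper half and are carried to full balls by folding: the
  normal derivative of the even extension may jump across the flat part, but \<open>u\<close>, the
  norm of its gradient and its radial derivative are reflection invariant and continuous on the
  whole ball.\<close>

lemma scale_measure_eq_density: "scale_measure (ennreal c) M = density M (\<lambda>_. ennreal c)"
  by (rule measure_eqI) (simp_all add: emeasure_density_const)

text \<open>Unfolds the pushforward in \<open>sphere_measure\<close>. The indicator is 1 except at
  the origin, which the projection sends to 0 because division by 0 gives 0; it is kept because
  \<open>f\<close> is only known to be continuous, hence measurable, on the sphere.\<close>

lemma sphere_integral_eq:
  fixes f :: "'a::euclidean_space \<Rightarrow> real"
  assumes "r > 0" and f: "continuous_on (sphere 0 r) f"
  shows "(LINT x:sphere 0 r|sphere_measure r. f x) =
    DIM('a) / r * (LINT x:ball 0 r|lborel. indicator (sphere 0 r) ((r / norm x) *\<^sub>R x) *\<^sub>R f ((r / norm x) *\<^sub>R x))"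
proof -
  let ?g = "\<lambda>x. indicator (sphere 0 r) x *\<^sub>R f x"
  have g [measurable]: "?g \<in> borel_measurable borel"
    by (intro borel_measurable_continuous_on_indicator f) auto
  have p: "(\<lambda>x::'a. (r / norm x) *\<^sub>R x) \<in> measurable (restrict_space lborel (ball 0 r)) borel"
    by (intro measurable_restrict_space1) simp
  have "(LINT x:sphere 0 r|sphere_measure r. f x) =
     DIM('a) / r * (\<integral>x. ?g x \<partial>distr (restrict_space lborel (ball 0 r)) borel (\<lambda>x::'a. (r / norm x) *\<^sub>R x))"
    unfolding sphere_measure_def set_lebesgue_integral_def scale_measure_eq_density
    using \<open>r > 0\<close> g by (subst integral_density) auto
  also have "\<dots> = DIM('a) / r * (LINT x:ball 0 r|lborel. ?g ((r / norm x) *\<^sub>R x))"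
    by (subst integral_distr[OF p g], subst integral_restrict_space) (simp_all add: set_lebesgue_integral_def)
  finally show ?thesis .
qed

text \<open>The substitution \<open>x = s y\<close> has Jacobian \<open>s ^ n\<close>, and
  \<open>hom\<close> removes the scaling from the integrand. Serves for volumes and for functions of
  the direction of \<open>x\<close> alone.\<close>

lemma set_integral_ball_scale:
  fixes k :: "'a::euclidean_space \<Rightarrow> real"
  assumes [measurable]: "k \<in> borel_measurable borel" and "s > 0"
    and hom: "\<And>x. k (s *\<^sub>R x) = k x"
  shows "(LINT x:ball 0 s|lborel. k x) = s ^ DIM('a) * (LINT x:ball 0 1|lborel. k x)"
proof -
  have ind: "indicator (ball 0 s) (s *\<^sub>R x) = (indicator (ball 0 1) x :: real)" for x :: 'a
    using \<open>s > 0\<close> by (auto simp: indicator_def)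
  have meas: "(\<lambda>x. indicator (ball 0 s) x * k x) \<in> borel_measurable borel"
    by (intro borel_measurable_times borel_measurable_indicator) auto
  have "(LINT x:ball 0 s|lborel. k x) =
      (\<integral>x. indicator (ball 0 s) x *\<^sub>R k x \<partial>density (distr lborel borel (\<lambda>x. 0 + s *\<^sub>R x)) (\<lambda>_. \<bar>s\<bar>^DIM('a)))"
    unfolding set_lebesgue_integral_def using \<open>s > 0\<close> by (subst (1) lborel_affine[of s 0]) auto
  also have "\<dots> = s ^ DIM('a) * (LINT x:ball 0 1|lborel. k x)"
    unfolding set_lebesgue_integral_def using \<open>s > 0\<close> meas
    by (subst integral_density) (auto simp: integral_distr hom ind)
  finally show ?thesis .
qed

lemma measure_ball_power:
  assumes "s > 0"
  shows "measure lborel (ball (0::'a::euclidean_space) s) = s ^ DIM('a) * measure lborel (ball (0::'a) 1)"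
  using set_integral_ball_scale[of "\<lambda>_::'a. 1" s] assms
  by (simp add: set_lebesgue_integral_def)

lemma set_integrable_ball:
  fixes f :: "'a::euclidean_space \<Rightarrow> real"
  assumes "continuous_on (ball 0 R) f" "s < R"
  shows "set_integrable lborel (ball 0 s) f"
proof -
  have "cball (0::'a) s \<subseteq> ball 0 R" using assms by auto
  then have "set_integrable lborel (cball 0 s) f"
    unfolding set_integrable_def using assms
    by (intro borel_integrable_compact) (auto intro: continuous_on_subset)
  then show ?thesis by (rule set_integrable_subset) auto
qed

text \<open>Only the shell between the two radii contributes, so a bound on \<open>k\<close> there
  is enough. The difference of volumes is kept exact because it is a multiple of a difference of
  powers of the radii.\<close>

lemma set_integral_ball_diff_le:
  fixes k :: "'a::euclidean_space \<Rightarrow> real"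
  assumes int: "set_integrable lborel (ball 0 t) k" and "s \<le> t"
    and bd: "\<And>x. s \<le> norm x \<Longrightarrow> norm x < t \<Longrightarrow> \<bar>k x\<bar> \<le> \<delta>"
  shows "\<bar>(LINT x:ball 0 t|lborel. k x) - (LINT x:ball 0 s|lborel. k x)\<bar>
     \<le> \<delta> * (measure lborel (ball (0::'a) t) - measure lborel (ball (0::'a) s))"
proof -
  have sub: "ball (0::'a) s \<subseteq> ball 0 t" using \<open>s \<le> t\<close> by auto
  have i2: "set_integrable lborel (ball 0 s) k" "set_integrable lborel (ball 0 t - ball 0 s) k"
    using int sub by (auto intro: set_integrable_subset)
  have one: "set_integrable lborel (ball (0::'a) t) (\<lambda>x. \<delta>)" 
      "set_integrable lborel (ball (0::'a) t - ball 0 s) (\<lambda>x. \<delta>)"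
     "set_integrable lborel (ball (0::'a) s) (\<lambda>x. \<delta>)"
    using set_integrable_ball[of "t + 1" "\<lambda>_::'a. \<delta>" t] sub by (auto intro: set_integrable_subset)
  have split: "ball (0::'a) t = ball 0 s \<union> (ball 0 t - ball 0 s)" using sub by auto
  have "(LINT x:ball 0 t|lborel. k x) - (LINT x:ball 0 s|lborel. k x) = (LINT x:ball 0 t - ball 0 s|lborel. k x)"
    by (subst split, subst set_integral_Un) (use i2 in auto)
  moreover have "\<bar>LINT x:ball 0 t - ball 0 s|lborel. k x\<bar> \<le> (LINT x:ball (0::'a) t - ball 0 s|lborel. \<delta>)"
    unfolding set_lebesgue_integral_def
    using i2(2) one(2) bd unfolding set_integrable_def
    by (intro order_trans[OF integral_abs_bound] integral_mono) (auto simp: indicator_def)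
  moreover have "(LINT x:ball (0::'a) t - ball 0 s|lborel. \<delta>) = (LINT x:ball (0::'a) t|lborel. \<delta>) - (LINT x:ball (0::'a) s|lborel. \<delta>)"
    by (subst (2) split, subst set_integral_Un) (use one in auto)
  ultimately show ?thesis
    by (simp add: set_lebesgue_integral_def algebra_simps)
qed

text \<open>The power \<open>s ^ n\<close> has a finite slope at \<open>r\<close>, so the difference
  quotient of \<open>E\<close> is bounded by an arbitrarily small multiple of \<open>V\<close> times
  that slope.\<close>

lemma has_real_derivative_zero_of_power_bound:
  fixes E :: "real \<Rightarrow> real"
  assumes "V \<ge> 0"
    and bd: "\<And>\<epsilon>. \<epsilon> > 0 \<Longrightarrow> \<forall>\<^sub>F s in at r. \<bar>E s - E r\<bar> \<le> \<epsilon> * (V * \<bar>s ^ n - r ^ n\<bar>)"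
  shows "(E has_real_derivative 0) (at r)"
  unfolding has_field_derivative_iff
proof (rule tendstoI)
  fix e :: real assume "e > 0"
  define D where "D = real n * r ^ (n - 1)"
  \<comment> \<open>\<open>\<bar>D\<bar> + 1\<close> bounds the slopes of \<open>s ^ n\<close> near
    \<open>r\<close>; the last \<open>+ 1\<close> keeps the denominator positive when
    \<open>V = 0\<close> and makes the final estimate strict.\<close>
  define \<epsilon> where "\<epsilon> = e / (V * (\<bar>D\<bar> + 1) + 1)"
  have pos: "V * (\<bar>D\<bar> + 1) + 1 > 0" using \<open>V \<ge> 0\<close> by (simp add: add_nonneg_pos)
  then have "\<epsilon> > 0" using \<open>e > 0\<close> by (simp add: \<epsilon>_def)
  have "((\<lambda>s. s ^ n) has_real_derivative D) (at r)"
    unfolding D_def by (auto intro!: derivative_eq_intros)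
  then have "((\<lambda>s. \<bar>(s ^ n - r ^ n) / (s - r)\<bar>) \<longlongrightarrow> \<bar>D\<bar>) (at r)"
    unfolding has_field_derivative_iff by (rule tendsto_rabs)
  then have "\<forall>\<^sub>F s in at r. \<bar>(s ^ n - r ^ n) / (s - r)\<bar> < \<bar>D\<bar> + 1"
    by (rule order_tendstoD) simp
  then show "\<forall>\<^sub>F s in at r. dist ((E s - E r) / (s - r)) 0 < e"
    using bd[OF \<open>\<epsilon> > 0\<close>] eventually_neq_at_within[of r]
  proof eventually_elim
    case (elim s)
    have "\<bar>(E s - E r) / (s - r)\<bar> \<le> \<epsilon> * (V * \<bar>s ^ n - r ^ n\<bar>) / \<bar>s - r\<bar>"
      using elim by (simp add: divide_right_mono)
    also have "\<dots> = \<epsilon> * (V * \<bar>(s ^ n - r ^ n) / (s - r)\<bar>)" by simp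
    also have "\<dots> \<le> \<epsilon> * (V * (\<bar>D\<bar> + 1))"
      using elim \<open>\<epsilon> > 0\<close> \<open>V \<ge> 0\<close> by (intro mult_left_mono) auto
    also have "\<dots> < \<epsilon> * (V * (\<bar>D\<bar> + 1) + 1)" using \<open>\<epsilon> > 0\<close> by (intro mult_strict_left_mono) auto
    also have "\<dots> = e" using pos by (simp add: \<epsilon>_def)
    finally show ?case by simp
  qed
qed

text \<open>Near the sphere of radius \<open>r\<close> the function \<open>f\<close> is compared with its radial projection
  \<open>f (r x / \<bar>x\<bar>)\<close>, whose integral over a ball of radius \<open>s\<close> is a multiple of \<open>s\<^sup>n\<close>.\<close>

lemma has_real_derivative_ball_integral:
  fixes f :: "'a::euclidean_space \<Rightarrow> real"
  assumes f: "continuous_on (ball 0 R) f" and r: "0 < r" "r < R"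
  shows "((\<lambda>s. LINT x:ball 0 s|lborel. f x) has_real_derivative
           (LINT x:sphere 0 r|sphere_measure r. f x)) (at r)"
proof -
  define V where "V = measure lborel (ball (0::'a) 1)"
  let ?n = "DIM('a)"
  define k0 where "k0 = (\<lambda>x::'a. indicator (sphere 0 r) ((r / norm x) *\<^sub>R x) *\<^sub>R f ((r / norm x) *\<^sub>R x))"
  define E where "E = (\<lambda>s. LINT x:ball 0 s|lborel. f x - k0 x)"
  define c where "c = (LINT x:ball 0 1|lborel. k0 x)"
  have fs: "continuous_on (sphere 0 r) f"
    by (rule continuous_on_subset[OF f]) (use r in auto)
  have "(\<lambda>x. indicator (sphere 0 r) x *\<^sub>R f x) \<in> borel_measurable borel"
    by (intro borel_measurable_continuous_on_indicator fs) auto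
  then have k0_meas [measurable]: "k0 \<in> borel_measurable borel"
    unfolding k0_def by (rule measurable_compose[rotated]) simp
  obtain M where M: "\<And>x. norm x = r \<Longrightarrow> \<bar>f x\<bar> \<le> M"
    using compact_imp_bounded[OF compact_continuous_image[OF fs compact_sphere]]
    unfolding bounded_iff by fastforce
  have k0_bd: "\<bar>k0 x\<bar> \<le> max 0 M" for x
    unfolding k0_def by (auto simp: indicator_def M le_max_iff_disj)
  have k0_int: "set_integrable lborel (ball 0 s) k0" for s
    unfolding set_integrable_def using emeasure_lborel_ball_finite k0_bd
    by (intro integrableI_bounded_set_indicator[where B = "max 0 M"]) auto
  have k_int: "set_integrable lborel (ball 0 s) (\<lambda>x. f x - k0 x)" if "s < R" for s
    using set_integrable_ball[OF f that] k0_int by (rule set_integral_diff)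
  have k0_scale: "(LINT x:ball 0 s|lborel. k0 x) = s ^ ?n * c" if "s > 0" for s
    unfolding c_def using that by (intro set_integral_ball_scale k0_meas) (auto simp: k0_def)
  \<comment> \<open>The factor \<open>n / r\<close> in \<open>sphere_measure\<close> makes the
    sphere integral equal to the derivative of \<open>s ^ n * c\<close> at \<open>r\<close>.\<close>
  have S: "(LINT x:sphere 0 r|sphere_measure r. f x) = ?n * r ^ (?n - 1) * c"
  proof -
    have "r ^ ?n = r * r ^ (?n - 1)" by (metis DIM_positive Suc_diff_1 power_Suc)
    then show ?thesis
      using k0_scale[OF r(1)] r(1) unfolding sphere_integral_eq[OF r(1) fs] k0_def[symmetric]
      by simp
  qed
  have split: "(LINT x:ball 0 s|lborel. f x) = E s + s ^ ?n * c" if "0 < s" "s < R" for s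
    using set_integral_diff(2)[OF set_integrable_ball[OF f that(2)] k0_int] k0_scale[OF that(1)]
    by (simp add: E_def)
  \<comment> \<open>A point \<open>x\<close> has distance \<open>\<bar>norm x - r\<bar>\<close> from
    its projection, so uniform continuity on a slightly larger closed ball makes
    \<open>f - k0\<close> small on the shell between \<open>r\<close> and \<open>s\<close>. Hence
    \<open>E\<close> has derivative 0.\<close>
  have Ebd: "\<forall>\<^sub>F s in at r. \<bar>E s - E r\<bar> \<le> \<epsilon> * (V * \<bar>s ^ ?n - r ^ ?n\<bar>)" if "\<epsilon> > 0" for \<epsilon>
  proof -
    define \<rho> where "\<rho> = (r + R) / 2"
    have \<rho>: "r < \<rho>" "\<rho> < R" using r by (auto simp: \<rho>_def)
    have "uniformly_continuous_on (cball 0 \<rho>) f"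
      by (intro compact_uniformly_continuous continuous_on_subset[OF f]) (use \<rho> in auto)
    then obtain d where d: "d > 0"
        "\<And>x y. x \<in> cball 0 \<rho> \<Longrightarrow> y \<in> cball 0 \<rho> \<Longrightarrow> dist y x < d \<Longrightarrow> dist (f y) (f x) < \<epsilon>"
      unfolding uniformly_continuous_on_def using \<open>\<epsilon> > 0\<close> by metis
    have kbd: "\<bar>f x - k0 x\<bar> \<le> \<epsilon>" if x: "norm x \<noteq> 0" "norm x \<le> \<rho>" "\<bar>norm x - r\<bar> < d" for x
    proof -
      let ?y = "(r / norm x) *\<^sub>R x"
      have y: "norm ?y = r" using x r by simp
      have "x - ?y = ((norm x - r) / norm x) *\<^sub>R x" using x by (simp add: algebra_simps diff_divide_distrib)
      then have "dist x ?y = \<bar>norm x - r\<bar>" using x by (simp add: dist_norm)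
      then have "dist (f x) (f ?y) < \<epsilon>" using x y \<rho> by (intro d) auto
      then show ?thesis using y by (simp add: k0_def dist_real_def)
    qed
    have Vs: "measure lborel (ball (0::'a) s) = s ^ ?n * V" if "s > 0" for s
      unfolding V_def using measure_ball_power[OF that] .
    have "\<forall>\<^sub>F s in at r. \<bar>s - r\<bar> < d \<and> 0 < s \<and> s < \<rho>"
      using eventually_at_in_open'[of "ball r d \<inter> {0<..<\<rho>}" r, OF open_Int] \<open>d > 0\<close> r \<rho>
      by (auto elim!: eventually_mono simp: dist_real_def abs_minus_commute)
    then show ?thesis
    proof eventually_elim
      case (elim s)
      show ?case
      proof (cases "r \<le> s")
        case True
        have "\<bar>E s - E r\<bar> \<le> \<epsilon> * (measure lborel (ball (0::'a) s) - measure lborel (ball (0::'a) r))"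
          unfolding E_def using elim True \<rho> r by (intro set_integral_ball_diff_le k_int kbd) auto
        also have "\<dots> = \<epsilon> * (V * (s ^ ?n - r ^ ?n))" using r elim by (simp add: Vs algebra_simps)
        also have "\<dots> \<le> \<epsilon> * (V * \<bar>s ^ ?n - r ^ ?n\<bar>)"
          using \<open>\<epsilon> > 0\<close> by (intro mult_left_mono) (auto simp: V_def)
        finally show ?thesis .
      next
        case False
        have "\<bar>E r - E s\<bar> \<le> \<epsilon> * (measure lborel (ball (0::'a) r) - measure lborel (ball (0::'a) s))"
          unfolding E_def using elim False \<rho> r by (intro set_integral_ball_diff_le k_int kbd) auto
        also have "\<dots> = \<epsilon> * (V * (r ^ ?n - s ^ ?n))" using r elim by (simp add: Vs algebra_simps)
        also have "\<dots> \<le> \<epsilon> * (V * \<bar>s ^ ?n - r ^ ?n\<bar>)"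
          using \<open>\<epsilon> > 0\<close> by (intro mult_left_mono) (auto simp: V_def)
        finally show ?thesis by (simp add: abs_minus_commute)
      qed
    qed
  qed
  have "(E has_real_derivative 0) (at r)"
    by (rule has_real_derivative_zero_of_power_bound[OF _ Ebd]) (auto simp: V_def)
  then have "((\<lambda>s. E s + s ^ ?n * c) has_real_derivative ?n * r ^ (?n - 1) * c) (at r)"
    by (auto intro!: derivative_eq_intros)
  then show ?thesis unfolding S
  proof (rule has_field_derivative_transform_within_open[of _ _ _ "{0<..<R}"])
  qed (use r split in auto)
qed

section \<open>Directional derivatives\<close>

text \<open>By translation invariance every difference quotient of \<open>g\<close> has integral 0.
  The mean value theorem bounds the quotients by \<open>M\<close>, so dominated convergence passes
  to \<open>g'\<close>, which is measurable as their pointwise limit.\<close>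

lemma integral_directional_derivative_eq_0:
  fixes g :: "'a::euclidean_space \<Rightarrow> real"
  assumes der: "\<And>x. ((\<lambda>t. g (x + t *\<^sub>R b)) has_real_derivative g' x) (at 0)"
    and bd: "\<And>x. \<bar>g' x\<bar> \<le> M"
    and supp: "\<And>x. norm x > R \<Longrightarrow> g x = 0"
    and gi: "integrable lborel g"
  shows "integrable lborel g'" and "integral\<^sup>L lborel g' = 0"
proof -
  have [measurable]: "g \<in> borel_measurable borel"
    using borel_measurable_integrable[OF gi] by simp
  define t where "t = (\<lambda>k. 1 / real (Suc k))"
  have t: "t k > 0" "t k \<le> 1" for k by (auto simp: t_def)
  define s where "s = (\<lambda>k x. (g (x + t k *\<^sub>R b) - g x) / t k)"
  have [measurable]: "s k \<in> borel_measurable borel" for k unfolding s_def by measurable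
  have lim: "(\<lambda>k. s k x) \<longlonglongrightarrow> g' x" for x
  proof -
    have "((\<lambda>h. (g (x + h *\<^sub>R b) - g x) / h) \<longlongrightarrow> g' x) (at 0)"
      using der[of x] by (simp add: has_field_derivative_iff)
    moreover have "filterlim t (at 0) sequentially"
      unfolding filterlim_at t_def using LIMSEQ_inverse_real_of_nat
      by (auto simp: inverse_eq_divide)
    ultimately show ?thesis
      unfolding s_def by (rule filterlim_compose)
  qed
  have g'_meas [measurable]: "g' \<in> borel_measurable borel"
    by (rule borel_measurable_LIMSEQ_real[OF lim]) auto
  have s_bd: "\<bar>s k x\<bar> \<le> M" for k x
  proof -
    have "((\<lambda>h. g (x + h *\<^sub>R b)) has_real_derivative g' (x + h *\<^sub>R b)) (at h)" for h
      using DERIV_shift[of "\<lambda>h. g (x + h *\<^sub>R b)" "g' (x + h *\<^sub>R b)" 0 h] der[of "x + h *\<^sub>R b"]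
      by (simp add: algebra_simps scaleR_add_left)
    then obtain z where "g (x + t k *\<^sub>R b) - g (x + 0 *\<^sub>R b) = (t k - 0) * g' (x + z *\<^sub>R b)"
      using MVT2[of 0 "t k" "\<lambda>h. g (x + h *\<^sub>R b)" "\<lambda>h. g' (x + h *\<^sub>R b)"] t by blast
    then have "s k x = g' (x + z *\<^sub>R b)" using t[of k] by (simp add: s_def)
    then show ?thesis using bd by simp
  qed
  \<comment> \<open>The steps \<open>t k\<close> are at most 1, so all difference quotients vanish
    beyond radius \<open>R + norm b\<close>.\<close>
  define w where "w = (\<lambda>x::'a. M * indicator (cball 0 (R + norm b)) x)"
  have w: "integrable lborel w"
    unfolding w_def using emeasure_lborel_cball_finite[of "0::'a"] by (auto intro!: integrable_mult_right)
  have dom: "norm (s k x) \<le> w x" for k x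
  proof (cases "norm x \<le> R + norm b")
    case False
    have "norm (t k *\<^sub>R b) \<le> norm b" using t[of k] by (simp add: mult_left_le_one_le)
    moreover have "norm x \<le> norm (x + t k *\<^sub>R b) + norm (t k *\<^sub>R b)"
      using norm_triangle_ineq4[of "x + t k *\<^sub>R b" "t k *\<^sub>R b"] by simp
    ultimately have "norm (x + t k *\<^sub>R b) > R" "norm x > R" using False norm_ge_zero[of b] by linarith+
    then have "s k x = 0" by (simp add: s_def supp)
    then show ?thesis using False by (simp add: w_def)
  qed (use s_bd in \<open>auto simp: w_def\<close>)
  show "integrable lborel g'"
    by (rule integrable_dominated_convergence[of g' lborel s w]) (use w lim dom in auto)
  have "(\<lambda>k. integral\<^sup>L lborel (s k)) \<longlonglongrightarrow> integral\<^sup>L lborel g'"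
    by (rule integral_dominated_convergence[of g' lborel s w]) (use w lim dom in auto)
  moreover have "integral\<^sup>L lborel (s k) = 0" for k
  proof -
    have "integral\<^sup>L lborel g = integral\<^sup>L (distr lborel borel ((+) (t k *\<^sub>R b))) g"
      by (simp add: lborel_distr_plus)
    also have "\<dots> = (\<integral>x. g (x + t k *\<^sub>R b) \<partial>lborel)"
      by (subst integral_distr) (auto simp: add.commute)
    finally have eq: "(\<integral>x. g (x + t k *\<^sub>R b) \<partial>lborel) = integral\<^sup>L lborel g" by simp
    have "integrable (distr lborel borel ((+) (t k *\<^sub>R b))) g"
      using gi by (simp add: lborel_distr_plus)
    then have "integrable lborel (\<lambda>x. g (x + t k *\<^sub>R b))"
      by (subst (asm) integrable_distr_eq) (auto simp: add.commute)
    then show ?thesis using gi eq unfolding s_def by simp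
  qed
  ultimately show "integral\<^sup>L lborel g' = 0"
    by (simp add: LIMSEQ_const_iff)
qed

lemma has_real_derivative_along:
  assumes "f differentiable (at x)"
  shows "((\<lambda>t. f (x + t *\<^sub>R b)) has_real_derivative pderiv_dir b f x) (at 0)"
proof -
  have "(f has_derivative frechet_derivative f (at (x + 0 *\<^sub>R b))) (at (x + 0 *\<^sub>R b))"
    using assms by (simp add: frechet_derivative_works)
  moreover have "((\<lambda>t. x + t *\<^sub>R b) has_derivative (\<lambda>t. t *\<^sub>R b)) (at 0)"
    by (auto intro!: derivative_eq_intros)
  ultimately have "((\<lambda>t. f (x + t *\<^sub>R b)) has_derivative (\<lambda>t. frechet_derivative f (at (x + 0 *\<^sub>R b)) (t *\<^sub>R b))) (at 0)"
    using diff_chain_at[of "\<lambda>t. x + t *\<^sub>R b" "\<lambda>t. t *\<^sub>R b" 0 f] by (simp add: o_def)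
  moreover have "frechet_derivative f (at x) (t *\<^sub>R b) = t * pderiv_dir b f x" for t
    using linear_frechet_derivative[OF assms] by (simp add: linear_scale pderiv_dir_def)
  ultimately show ?thesis
    by (simp add: has_field_derivative_def mult_commute_abs)
qed

lemma has_real_derivative_along':
  assumes "f differentiable (at (x + t *\<^sub>R b))"
  shows "((\<lambda>t. f (x + t *\<^sub>R b)) has_real_derivative pderiv_dir b f (x + t *\<^sub>R b)) (at t)"
  using DERIV_shift[of "\<lambda>t. f (x + t *\<^sub>R b)" "pderiv_dir b f (x + t *\<^sub>R b)" 0 t]
    has_real_derivative_along[OF assms, of b]
  by (simp add: algebra_simps scaleR_add_left)

text \<open>Both mixed partials at a point are limits of the same second difference quotient.\<close>

lemma mixed_difference:
  fixes f :: "'a::euclidean_space \<Rightarrow> real"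
  assumes "\<And>s t. 0 \<le> s \<Longrightarrow> s \<le> h \<Longrightarrow> 0 \<le> t \<Longrightarrow> t \<le> h \<Longrightarrow> x + s *\<^sub>R b + t *\<^sub>R c \<in> S"
    and "\<And>x. x \<in> S \<Longrightarrow> f differentiable (at x)"
    and "\<And>x. x \<in> S \<Longrightarrow> pderiv_dir b f differentiable (at x)"
    and "h > 0"
  shows "\<exists>s t. 0 \<le> s \<and> s \<le> h \<and> 0 \<le> t \<and> t \<le> h \<and>
    f (x + h *\<^sub>R b + h *\<^sub>R c) - f (x + h *\<^sub>R b) - f (x + h *\<^sub>R c) + f x
      = h * h * pderiv_dir c (pderiv_dir b f) (x + s *\<^sub>R b + t *\<^sub>R c)"
proof -
  \<comment> \<open>The mean value theorem is used twice: in direction \<open>b\<close> for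
    \<open>F\<close>, the increment along \<open>c\<close>, and then along \<open>c\<close> for the
    derivative \<open>K\<close>.\<close>
  define F where "F = (\<lambda>s. f ((x + h *\<^sub>R c) + s *\<^sub>R b) - f (x + s *\<^sub>R b))"
  define F' where "F' = (\<lambda>s. pderiv_dir b f ((x + h *\<^sub>R c) + s *\<^sub>R b) - pderiv_dir b f (x + s *\<^sub>R b))"
  have "(F has_real_derivative F' s) (at s)" if "0 \<le> s" "s \<le> h" for s
    unfolding F_def F'_def
    using assms(1)[of s h] assms(1)[of s 0] assms(2) that \<open>h > 0\<close>
    by (intro DERIV_diff has_real_derivative_along') (auto simp: algebra_simps)
  then obtain s where s: "0 < s" "s < h" "F h - F 0 = (h - 0) * F' s"
    using MVT2[of 0 h F F'] \<open>h > 0\<close> by blast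
  define K where "K = (\<lambda>t. pderiv_dir b f ((x + s *\<^sub>R b) + t *\<^sub>R c))"
  have "(K has_real_derivative pderiv_dir c (pderiv_dir b f) ((x + s *\<^sub>R b) + t *\<^sub>R c)) (at t)"
    if "0 \<le> t" "t \<le> h" for t
    unfolding K_def using assms(1)[of s t] assms(3) that s by (intro has_real_derivative_along') auto
  then obtain t where t: "0 < t" "t < h"
      "K h - K 0 = (h - 0) * pderiv_dir c (pderiv_dir b f) ((x + s *\<^sub>R b) + t *\<^sub>R c)"
    using MVT2[of 0 h K "\<lambda>t. pderiv_dir c (pderiv_dir b f) ((x + s *\<^sub>R b) + t *\<^sub>R c)"] \<open>h > 0\<close> by blast
  have "F' s = K h - K 0" by (simp add: F'_def K_def algebra_simps)
  then have "F h - F 0 = h * h * pderiv_dir c (pderiv_dir b f) (x + s *\<^sub>R b + t *\<^sub>R c)"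
    using s t by simp
  moreover have "F h - F 0 = f (x + h *\<^sub>R b + h *\<^sub>R c) - f (x + h *\<^sub>R b) - f (x + h *\<^sub>R c) + f x"
    by (simp add: F_def algebra_simps)
  ultimately show ?thesis using s t
    by (intro exI[of _ s] exI[of _ t]) auto
qed

text \<open>The second difference is symmetric in \<open>b\<close> and \<open>c\<close>, so some
  value of \<open>?A\<close> near \<open>x\<close> equals some value of \<open>?B\<close> near
  \<open>x\<close>; continuity then rules out a gap at \<open>x\<close>. The cancellation of
  second-order terms in \<open>rellich_identity\<close> rests on this symmetry.\<close>

lemma mixed_partials_commute:
  fixes f :: "'a::euclidean_space \<Rightarrow> real"
  assumes "C2_on f S" "open S" "x \<in> S" "b \<in> Basis" "c \<in> Basis"
  shows "pderiv_dir c (pderiv_dir b f) x = pderiv_dir b (pderiv_dir c f) x"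
proof (rule ccontr)
  let ?A = "pderiv_dir c (pderiv_dir b f)" and ?B = "pderiv_dir b (pderiv_dir c f)"
  assume ne: "?A x \<noteq> ?B x"
  define e where "e = \<bar>?A x - ?B x\<bar> / 2"
  have "e > 0" using ne by (simp add: e_def)
  have "continuous_on S ?A" "continuous_on S ?B" using assms by (auto simp: C2_on_def)
  then have "isCont ?A x" "isCont ?B x" using assms by (auto simp: continuous_on_eq_continuous_at)
  then obtain d1 d2 where d: "d1 > 0" "\<And>y. dist y x < d1 \<Longrightarrow> dist (?A y) (?A x) < e"
     "d2 > 0" "\<And>y. dist y x < d2 \<Longrightarrow> dist (?B y) (?B x) < e"
    unfolding continuous_at_eps_delta using \<open>e > 0\<close> by (metis (no_types))
  obtain d3 where d3: "d3 > 0" "ball x d3 \<subseteq> S" using assms openE by blast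
  \<comment> \<open>Two steps of length \<open>h\<close> must stay within all three radii, hence the
    division by 3.\<close>
  define h where "h = min d1 (min d2 d3) / 3"
  have h: "h > 0" "2 * h < d1" "2 * h < d2" "2 * h < d3" using d d3 by (auto simp: h_def)
  have near: "dist (x + s *\<^sub>R v + t *\<^sub>R w) x \<le> 2 * h"
    if "0 \<le> s" "s \<le> h" "0 \<le> t" "t \<le> h" "v \<in> Basis" "w \<in> Basis" for s t and v w :: 'a
  proof -
    have "norm (s *\<^sub>R v + t *\<^sub>R w) \<le> norm (s *\<^sub>R v) + norm (t *\<^sub>R w)" by (rule norm_triangle_ineq)
    then show ?thesis using that by (simp add: dist_norm add.assoc)
  qed
  have inS: "x + s *\<^sub>R v + t *\<^sub>R w \<in> S"
    if "0 \<le> s" "s \<le> h" "0 \<le> t" "t \<le> h" "v \<in> Basis" "w \<in> Basis" for s t and v w :: 'a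
    using near[OF that] h d3 by (auto simp: dist_commute intro!: subsetD[OF d3(2)])
  have diff: "\<And>x. x \<in> S \<Longrightarrow> f differentiable (at x)"
    "\<And>b x. b \<in> Basis \<Longrightarrow> x \<in> S \<Longrightarrow> pderiv_dir b f differentiable (at x)"
    using assms(1) by (auto simp: C2_on_def)
  obtain s t where 1: "0 \<le> s" "s \<le> h" "0 \<le> t" "t \<le> h"
    "f (x + h *\<^sub>R b + h *\<^sub>R c) - f (x + h *\<^sub>R b) - f (x + h *\<^sub>R c) + f x = h * h * ?A (x + s *\<^sub>R b + t *\<^sub>R c)"
    using mixed_difference[of h x b c S f, OF inS[OF _ _ _ _ assms(4,5)] diff(1) diff(2)[OF assms(4)] h(1)]
    by blast
  obtain s' t' where 2: "0 \<le> s'" "s' \<le> h" "0 \<le> t'" "t' \<le> h"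
    "f (x + h *\<^sub>R c + h *\<^sub>R b) - f (x + h *\<^sub>R c) - f (x + h *\<^sub>R b) + f x = h * h * ?B (x + s' *\<^sub>R c + t' *\<^sub>R b)"
    using mixed_difference[of h x c b S f, OF inS[OF _ _ _ _ assms(5,4)] diff(1) diff(2)[OF assms(5)] h(1)]
    by blast
  have "h * h * ?A (x + s *\<^sub>R b + t *\<^sub>R c) = h * h * ?B (x + s' *\<^sub>R c + t' *\<^sub>R b)"
    using 1(5) 2(5) by (simp add: algebra_simps)
  then have "?A (x + s *\<^sub>R b + t *\<^sub>R c) = ?B (x + s' *\<^sub>R c + t' *\<^sub>R b)" using h by simp
  moreover have "dist (?A (x + s *\<^sub>R b + t *\<^sub>R c)) (?A x) < e" "dist (?B (x + s' *\<^sub>R c + t' *\<^sub>R b)) (?B x) < e"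
    using near 1 2 assms h by (intro d order.strict_trans1[OF near]; simp)+
  ultimately have "dist (?A x) (?B x) < 2 * e"
    by (simp add: dist_real_def)
  then show False by (simp add: e_def dist_real_def)
qed

section \<open>The divergence theorem for folded fields\<close>

text \<open>Squaring removes the corner of the positive part: at 0 the difference quotient is at
  most \<open>\<bar>h\<bar>\<close>. Both the radial weight and the height cutoff are built from
  this function.\<close>

lemma DERIV_max_0_square: "((\<lambda>s::real. (max 0 s)\<^sup>2) has_real_derivative 2 * max 0 s) (at s)"
proof -
  consider "s > 0" | "s < 0" | "s = 0" by linarith
  then show ?thesis
  proof cases
    case 1
    have "((\<lambda>s::real. s\<^sup>2) has_real_derivative 2 * max 0 s) (at s)"
      using 1 by (auto intro!: derivative_eq_intros)
    then show ?thesis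
      by (rule has_field_derivative_transform_within_open[where S = "{0<..}"]) (use 1 in auto)
  next
    case 2
    have "((\<lambda>s::real. 0) has_real_derivative 2 * max 0 s) (at s)"
      using 2 by (auto intro!: derivative_eq_intros)
    then show ?thesis
      by (rule has_field_derivative_transform_within_open[where S = "{..<0}"]) (use 2 in auto)
  next
    case 3
    have "((\<lambda>h::real. (max 0 h)\<^sup>2 / h) \<longlongrightarrow> 0) (at 0)"
    proof (rule Lim_null_comparison)
      show "\<forall>\<^sub>F h::real in at 0. norm ((max 0 h)\<^sup>2 / h) \<le> \<bar>h\<bar>"
        by (intro always_eventually) (auto simp: max_def power2_eq_square)
      show "((\<lambda>h::real. \<bar>h\<bar>) \<longlongrightarrow> 0) (at 0)" by (rule tendsto_eq_intros refl | simp)+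
    qed
    then show ?thesis using 3 by (simp add: has_field_derivative_iff)
  qed
qed

lemma DERIV_max_0_square_comp:
  fixes g :: "real \<Rightarrow> real"
  assumes "(g has_real_derivative D) (at x)"
  shows "((\<lambda>x. (max 0 (g x))\<^sup>2) has_real_derivative 2 * max 0 (g x) * D) (at x)"
  using DERIV_chain2[of "\<lambda>s. (max 0 s)\<^sup>2" "2 * max 0 (g x)" g x D] DERIV_max_0_square assms by blast

text \<open>\<open>h'\<close> is the piecewise linear tent over the interval from 1 to 2 with peak 2
  at 3/2, hence of area 1, and \<open>h\<close> is its antiderivative. The bounds 3 and 4 are crude;
  they serve as uniform constants for dominated convergence and for the boundary layer.\<close>

lemma C1_cutoff_exists:
  "\<exists>h h' :: real \<Rightarrow> real. (\<forall>s. (h has_real_derivative h' s) (at s)) \<and> continuous_on UNIV h' \<and>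
    (\<forall>s\<le>1. h s = 0 \<and> h' s = 0) \<and> (\<forall>s\<ge>2. h s = 1 \<and> h' s = 0) \<and> (\<forall>s. \<bar>h s\<bar> \<le> 3 \<and> \<bar>h' s\<bar> \<le> 4)"
proof -
  define p where "p = (\<lambda>s::real. (max 0 s)\<^sup>2)"
  define h where "h = (\<lambda>s. 2 * (p (s - 1) - 2 * p (s - 3/2) + p (s - 2)))"
  define h' where "h' = (\<lambda>s::real. 4 * (max 0 (s - 1) - 2 * max 0 (s - 3/2) + max 0 (s - 2)))"
  have p: "((\<lambda>s. p (s - a)) has_real_derivative 2 * max 0 (s - a)) (at s)" for a s
  proof -
    have "((\<lambda>s. s - a) has_real_derivative 1) (at s)" by (auto intro!: derivative_eq_intros)
    then show ?thesis
      unfolding p_def using DERIV_max_0_square_comp by fastforce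
  qed
  have der: "(h has_real_derivative h' s) (at s)" for s
    unfolding h_def h'_def by (rule derivative_eq_intros p refl)+ simp
  have cont: "continuous_on UNIV h'" unfolding h'_def by (intro continuous_intros)
  have zero: "s \<le> 1 \<Longrightarrow> h s = 0" "s \<le> 1 \<Longrightarrow> h' s = 0" "s \<ge> 2 \<Longrightarrow> h' s = 0" for s
    by (auto simp: h_def h'_def p_def)
  have h1: "h s = 1" if "s \<ge> 2" for s
    using that by (simp add: h_def p_def power2_eq_square algebra_simps)
  have bd': "\<bar>h' s\<bar> \<le> 4" for s unfolding h'_def by (auto simp: max_def)
  have bd: "\<bar>h s\<bar> \<le> 3" for s
  proof (cases "s \<ge> 2")
    case False
    then have "max 0 (s - 3/2) \<le> 1/2" by (simp add: max_def)
    then have "p (s - 3/2) \<le> (1/2)\<^sup>2" unfolding p_def by (intro power_mono) auto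
    moreover have "0 \<le> p (s - 1)" "p (s - 1) \<le> 1" "0 \<le> p (s - 3/2)" "p (s - 2) = 0"
      using False unfolding p_def by (auto intro!: power_le_one)
    ultimately show ?thesis unfolding h_def by (simp add: power2_eq_square)
  qed (simp add: h1)
  show ?thesis using der cont zero h1 bd bd' by blast
qed

section \<open>The weighted divergence identity on the half ball\<close>

lemma upper_flat_eq: "upper_ball \<union> flat_ball = ball 0 1 \<inter> {x. snd x \<ge> 0}"
  by (auto simp: upper_ball_def flat_ball_def)

lemma open_upper_ball: "open (upper_ball :: ((real ^ 'm::finite) \<times> real) set)"
  unfolding upper_ball_def
  by (intro open_Int open_ball open_Collect_less continuous_intros)

text \<open>The integrand is the divergence of \<open>(q x)\<^sup>2 * \<phi> (snd x)\<close> times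
  \<open>W\<close>: the gradient of \<open>q\<^sup>2\<close> is \<open>- 4 q(x) x\<close>, and the
  cutoff contributes \<open>\<phi>'\<close> times the last component of \<open>W\<close>. The
  support lies in a compact subset of the open half ball, where \<open>W\<close> has its
  derivatives.\<close>

lemma cutoff_divergence_integral:
  fixes W :: "(real ^ 'm::finite) \<times> real \<Rightarrow> (real ^ 'm) \<times> real"
  assumes der: "\<And>b x. b \<in> Basis \<Longrightarrow> x \<in> upper_ball \<Longrightarrow>
        ((\<lambda>t. W (x + t *\<^sub>R b) \<bullet> b) has_real_derivative D b x) (at 0)"
    and D: "\<And>b. b \<in> Basis \<Longrightarrow> continuous_on upper_ball (D b)"
    and W: "continuous_on upper_ball W"
    and f: "\<And>x. x \<in> upper_ball \<Longrightarrow> f x = (\<Sum>b\<in>Basis. D b x)"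
    and r: "0 < r" "r < 1" and "\<epsilon> > 0"
    and \<phi>: "\<And>s. (\<phi> has_real_derivative \<phi>' s) (at s)" "continuous_on UNIV \<phi>'"
    and \<phi>0: "\<And>s. s \<le> \<epsilon> \<Longrightarrow> \<phi> s = 0" "\<And>s. s \<le> \<epsilon> \<Longrightarrow> \<phi>' s = 0"
    and q: "\<And>x. q x = max 0 (r\<^sup>2 - x \<bullet> x)"
  shows "(\<integral>x. (q x)\<^sup>2 * \<phi> (snd x) * f x - 4 * q x * \<phi> (snd x) * (x \<bullet> W x)
       + (q x)\<^sup>2 * \<phi>' (snd x) * snd (W x) \<partial>lborel) = 0"
proof -
  define K where "K = cball 0 r \<inter> {x :: (real ^ 'm) \<times> real. snd x \<ge> \<epsilon>}"
  have K_closed: "closed {x :: (real ^ 'm) \<times> real. snd x \<ge> \<epsilon>}"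
    by (intro closed_Collect_le continuous_intros)
  have K: "compact K" unfolding K_def by (intro compact_Int_closed compact_cball K_closed)
  have K_sub: "K \<subseteq> upper_ball" using r \<open>\<epsilon> > 0\<close> by (auto simp: K_def upper_ball_def)
  have q0: "q x = 0 \<or> (\<phi> (snd x) = 0 \<and> \<phi>' (snd x) = 0)" if "x \<notin> K" for x
  proof (cases "norm x \<le> r")
    case False
    then have "r\<^sup>2 \<le> (norm x)\<^sup>2" using r by (intro power_mono) auto
    then show ?thesis by (simp add: q dot_square_norm)
  qed (use that \<phi>0 in \<open>auto simp: K_def\<close>)
  define g where "g = (\<lambda>b x. (q x)\<^sup>2 * \<phi> (snd x) * (W x \<bullet> b))"
  define g' where "g' = (\<lambda>b x. - 4 * q x * (x \<bullet> b) * \<phi> (snd x) * (W x \<bullet> b)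
     + (q x)\<^sup>2 * (\<phi>' (snd x) * snd b) * (W x \<bullet> b) + (q x)\<^sup>2 * \<phi> (snd x) * D b x)"
  have g_off: "g b x = 0" "g' b x = 0" if "x \<notin> K" for b x
    using q0[OF that] by (auto simp: g_def g'_def)
  have cont_\<phi>: "continuous_on S \<phi>" for S
    using \<phi>(1) by (meson DERIV_continuous_on has_field_derivative_at_within)
  have cont_\<phi>': "continuous_on S \<phi>'" for S
    using \<phi>(2) continuous_on_subset by blast
  have cont_q: "continuous_on S q" for S
    unfolding q[abs_def] by (intro continuous_intros)
  have WK: "continuous_on K W" using W K_sub continuous_on_subset by blast
  have g_der: "((\<lambda>t. g b (x + t *\<^sub>R b)) has_real_derivative g' b x) (at 0)" if b: "b \<in> Basis" for b x
  proof (cases "x \<in> upper_ball")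
    case True
    have "((\<lambda>t. r\<^sup>2 - (x + t *\<^sub>R b) \<bullet> (x + t *\<^sub>R b)) has_real_derivative - 2 * (x \<bullet> b)) (at 0)"
      by (auto intro!: derivative_eq_intros simp: algebra_simps inner_add inner_commute)
    then have 1: "((\<lambda>t. (q (x + t *\<^sub>R b))\<^sup>2) has_real_derivative 2 * q x * (- 2 * (x \<bullet> b))) (at 0)"
      unfolding q using DERIV_max_0_square_comp by fastforce
    have "((\<lambda>t. snd (x + t *\<^sub>R b)) has_real_derivative snd b) (at 0)"
      by (auto intro!: derivative_eq_intros)
    then have 2: "((\<lambda>t. \<phi> (snd (x + t *\<^sub>R b))) has_real_derivative \<phi>' (snd x) * snd b) (at 0)"
      using DERIV_chain2[of \<phi> "\<phi>' (snd x)" "\<lambda>t. snd (x + t *\<^sub>R b)" 0] \<phi>(1) by simp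
    show ?thesis unfolding g_def g'_def
      by (rule DERIV_cong[OF DERIV_mult[OF DERIV_mult[OF 1 2] der[OF b True]]]) (simp add: algebra_simps)
  next
    case False
    then have "x \<notin> K" using K_sub by auto
    \<comment> \<open>Nothing is known of the derivatives of \<open>W\<close> outside the open half
      ball; there \<open>g b\<close> vanishes near \<open>x\<close> because the complement of the
      compact set \<open>K\<close> is open.\<close>
    have op: "open ((\<lambda>t. x + t *\<^sub>R b) -` (- K))"
      using compact_imp_closed[OF K] by (intro open_vimage continuous_intros) auto
    have "((\<lambda>t. 0) has_real_derivative g' b x) (at 0)" using g_off[OF \<open>x \<notin> K\<close>] by simp
    then show ?thesis
      by (rule has_field_derivative_transform_within_open[OF _ op])
         (use \<open>x \<notin> K\<close> g_off in auto)
  qed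
  have int: "integrable lborel (g' b)" "integral\<^sup>L lborel (g' b) = 0" if b: "b \<in> Basis" for b
  proof -
    have "continuous_on K (g b)" unfolding g_def
      by (intro continuous_intros WK cont_q continuous_on_compose2[OF cont_\<phi>]) auto
    then have "integrable lborel (\<lambda>x. indicator K x *\<^sub>R g b x)"
      by (intro borel_integrable_compact K)
    moreover have "indicator K x *\<^sub>R g b x = g b x" for x
      using g_off(1)[of x b] by (cases "x \<in> K") simp_all
    ultimately have gi: "integrable lborel (g b)" by (simp only:)
    have "continuous_on K (D b)" using D[OF b] K_sub continuous_on_subset by blast
    then have "continuous_on K (g' b)" unfolding g'_def
      by (intro continuous_intros WK cont_q continuous_on_compose2[OF cont_\<phi>] continuous_on_compose2[OF cont_\<phi>']) auto
    then have "bounded (g' b ` K)" using K compact_continuous_image compact_imp_bounded by blast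
    then obtain M where M: "\<And>x. x \<in> K \<Longrightarrow> \<bar>g' b x\<bar> \<le> M" unfolding bounded_iff by auto
    have bd: "\<bar>g' b x\<bar> \<le> max 0 M" for x
      using M[of x] g_off(2)[of x b] by (cases "x \<in> K") (auto simp: le_max_iff_disj)
    have supp: "g b x = 0" if "norm x > r" for x
      using that by (intro g_off) (auto simp: K_def)
    show "integrable lborel (g' b)" "integral\<^sup>L lborel (g' b) = 0"
      using integral_directional_derivative_eq_0[OF g_der[OF b] bd supp gi] by auto
  qed
  have sum: "(\<Sum>b\<in>Basis. g' b x) = (q x)\<^sup>2 * \<phi> (snd x) * f x - 4 * q x * \<phi> (snd x) * (x \<bullet> W x)
       + (q x)\<^sup>2 * \<phi>' (snd x) * snd (W x)" for x
  proof (cases "x \<in> upper_ball")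
    case True
    have *: "snd (W x) = (\<Sum>b\<in>Basis. snd b * (W x \<bullet> b))"
      using euclidean_inner[of "(0, 1)" "W x"] by (simp add: inner_prod_def)
    show ?thesis
      unfolding g'_def f[OF True] * euclidean_inner[of x "W x"]
      by (simp add: sum.distrib sum_subtractf sum_negf sum_distrib_left sum_distrib_right algebra_simps)
  next
    case False
    then have "x \<notin> K" using K_sub by auto
    then show ?thesis using g_off(2) q0[of x] by auto
  qed
  have "(\<integral>x. (\<Sum>b\<in>Basis. g' b x) \<partial>lborel) = 0"
    using int by (subst Bochner_Integration.integral_sum) auto
  then show ?thesis by (simp only: sum)
qed

text \<open>The reflection is a diagonal map with entries 1 and -1, so its Jacobian factor is 1 and
  it preserves \<open>lborel\<close>.\<close>

lemma integral_reflect_snd: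
  fixes k :: "(real ^ 'm::finite) \<times> real \<Rightarrow> real"
  assumes [measurable]: "k \<in> borel_measurable borel"
  shows "(\<integral>x. k (fst x, - snd x) \<partial>lborel) = integral\<^sup>L lborel k"
    and "integrable lborel k \<Longrightarrow> integrable lborel (\<lambda>x. k (fst x, - snd x))"
proof -
  let ?T = "\<lambda>x::(real ^ 'm) \<times> real. (fst x, - snd x)"
  have [measurable]: "?T \<in> borel_measurable borel"
    by (intro borel_measurable_continuous_onI continuous_intros)
  define c :: "(real ^ 'm) \<times> real \<Rightarrow> real" where "c = (\<lambda>j. if j = (0, 1) then -1 else 1)"
  have T: "0 + (\<Sum>j\<in>Basis. (c j * (x \<bullet> j)) *\<^sub>R j) = ?T x" for x
  proof (rule euclidean_eqI)
    fix b :: "(real ^ 'm) \<times> real" assume b: "b \<in> Basis"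
    then have "(0 + (\<Sum>j\<in>Basis. (c j * (x \<bullet> j)) *\<^sub>R j)) \<bullet> b = c b * (x \<bullet> b)"
      by simp
    also have "\<dots> = ?T x \<bullet> b"
      using b by (auto simp: c_def Basis_prod_def inner_prod_def)
    finally show "(0 + (\<Sum>j\<in>Basis. (c j * (x \<bullet> j)) *\<^sub>R j)) \<bullet> b = ?T x \<bullet> b" .
  qed
  have "lborel = density (distr lborel borel ?T) (\<lambda>_. (\<Prod>j\<in>Basis. \<bar>c j\<bar>))"
    using lborel_affine_euclidean[of c 0, unfolded T] by (simp add: c_def)
  also have "(\<Prod>j\<in>Basis. \<bar>c j\<bar>) = 1"
    by (intro prod.neutral) (simp add: c_def)
  finally have L: "distr lborel borel ?T = lborel" by (simp add: density_1)
  have "integral\<^sup>L lborel k = integral\<^sup>L (distr lborel borel ?T) k" by (simp add: L)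
  also have "\<dots> = (\<integral>x. k (fst x, - snd x) \<partial>lborel)"
    by (subst integral_distr) auto
  finally show "(\<integral>x. k (fst x, - snd x) \<partial>lborel) = integral\<^sup>L lborel k" ..
  show "integrable lborel (\<lambda>x. k (fst x, - snd x))" if "integrable lborel k"
    using that by (subst (asm) L[symmetric], subst (asm) integrable_distr_eq) auto
qed

lemma AE_snd_neq_0: "AE x in lborel. snd (x :: (real ^ 'm::finite) \<times> real) \<noteq> 0"
proof -
  have "(0, 1) \<in> (Basis :: ((real ^ 'm) \<times> real) set)" by (simp add: Basis_prod_def)
  then have "negligible {x :: (real ^ 'm) \<times> real. x \<bullet> (0, 1) = 0}"
    by (rule negligible_standard_hyperplane)
  then have "{x :: (real ^ 'm) \<times> real. snd x = 0} \<in> null_sets lebesgue"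
    by (simp add: negligible_iff_null_sets inner_prod_def)
  then have "AE x in lebesgue. snd (x :: (real ^ 'm) \<times> real) \<noteq> 0"
    by (rule AE_I') auto
  then show ?thesis by (simp add: AE_completion_iff)
qed

text \<open>Limit of the cutoff identity as the height tends to 0. Its volume terms converge by
  dominated convergence, since \<open>f\<close> and \<open>W\<close> are continuous up to the flat
  part. The layer term has a factor of order \<open>1 / \<epsilon>\<close> on a slab of volume of
  order \<open>\<epsilon>\<close>, times \<open>snd (W x)\<close>, which is uniformly small there
  because of \<open>flat\<close>.\<close>

lemma half_ball_divergence:
  fixes W :: "(real ^ 'm::finite) \<times> real \<Rightarrow> (real ^ 'm) \<times> real"
  assumes der: "\<And>b x. b \<in> Basis \<Longrightarrow> x \<in> upper_ball \<Longrightarrow>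
        ((\<lambda>t. W (x + t *\<^sub>R b) \<bullet> b) has_real_derivative D b x) (at 0)"
    and D: "\<And>b. b \<in> Basis \<Longrightarrow> continuous_on upper_ball (D b)"
    and W: "continuous_on (upper_ball \<union> flat_ball) W"
    and f: "continuous_on (upper_ball \<union> flat_ball) f" "\<And>x. x \<in> upper_ball \<Longrightarrow> f x = (\<Sum>b\<in>Basis. D b x)"
    and flat: "\<And>x. x \<in> flat_ball \<Longrightarrow> snd (W x) = 0"
    and r: "0 < r" "r < 1"
  defines "Y \<equiv> \<lambda>x. (r\<^sup>2 - x \<bullet> x)\<^sup>2 * f x - 4 * (r\<^sup>2 - x \<bullet> x) * (x \<bullet> W x)"
  shows "set_integrable lborel (cball 0 r \<inter> {x. snd x > 0}) Y"
    and "(LINT x:cball 0 r \<inter> {x. snd x > 0}|lborel. Y x) = 0"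
proof -
  define q where "q = (\<lambda>x :: (real ^ 'm) \<times> real. max 0 (r\<^sup>2 - x \<bullet> x))"
  define K where "K = cball 0 r \<inter> {x :: (real ^ 'm) \<times> real. snd x \<ge> 0}"
  define U where "U = {x :: (real ^ 'm) \<times> real. snd x > 0}"
  have cl: "closed {x :: (real ^ 'm) \<times> real. snd x \<ge> 0}"
    by (intro closed_Collect_le continuous_intros)
  have "open U" unfolding U_def by (intro open_Collect_less continuous_intros)
  then have [measurable]: "U \<in> sets borel" by simp
  have K: "compact K" unfolding K_def by (intro compact_Int_closed compact_cball cl)
  have K_sub: "K \<subseteq> upper_ball \<union> flat_ball" using r by (auto simp: K_def upper_flat_eq)
  have WK: "continuous_on K W" "continuous_on K f" using W f(1) K_sub continuous_on_subset by blast+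
  define YK where "YK = (\<lambda>x. indicator K x *\<^sub>R Y x)"
  have YK: "integrable lborel YK" unfolding YK_def Y_def
    by (intro borel_integrable_compact K continuous_intros WK)
  have [measurable]: "YK \<in> borel_measurable borel" using borel_measurable_integrable[OF YK] by simp
  have ind: "indicator (cball 0 r \<inter> {x. snd x > 0}) x *\<^sub>R Y x = indicator U x *\<^sub>R YK x" for x
    by (auto simp: indicator_def U_def K_def YK_def)
  show "set_integrable lborel (cball 0 r \<inter> {x. snd x > 0}) Y"
    unfolding set_integrable_def ind by (intro integrable_mult_indicator YK) auto
  obtain h h' :: "real \<Rightarrow> real" where h: "\<And>s. (h has_real_derivative h' s) (at s)" "continuous_on UNIV h'"
    "\<And>s. s \<le> 1 \<Longrightarrow> h s = 0" "\<And>s. s \<le> 1 \<Longrightarrow> h' s = 0" "\<And>s. s \<ge> 2 \<Longrightarrow> h s = 1" "\<And>s. s \<ge> 2 \<Longrightarrow> h' s = 0"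
    "\<And>s. \<bar>h s\<bar> \<le> 3" "\<And>s. \<bar>h' s\<bar> \<le> 4"
    using C1_cutoff_exists by metis
  have cont_h: "continuous_on UNIV h"
    using h(1) by (meson DERIV_continuous_on has_field_derivative_at_within)
  have [measurable]: "h \<in> borel_measurable borel"
    using cont_h by (rule borel_measurable_continuous_onI)
  define \<epsilon> where "\<epsilon> = (\<lambda>k. 1 / real (Suc k))"
  have \<epsilon>: "\<epsilon> k > 0" for k by (simp add: \<epsilon>_def)
  have \<epsilon>_lim: "\<epsilon> \<longlonglongrightarrow> 0" unfolding \<epsilon>_def using LIMSEQ_inverse_real_of_nat by (simp add: inverse_eq_divide)
  \<comment> \<open>\<open>A\<close> collects the volume terms and \<open>B\<close> the term from
    the derivative of the cutoff; their integrals cancel for every \<open>k\<close>.\<close>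
  define A where "A = (\<lambda>k x. h (snd x / \<epsilon> k) * YK x)"
  define B where "B = (\<lambda>k x. indicator K x *\<^sub>R ((q x)\<^sup>2 * (h' (snd x / \<epsilon> k) / \<epsilon> k) * snd (W x)))"
  have AB: "(\<integral>x. A k x + B k x \<partial>lborel) = 0" for k
  proof -
    have "((\<lambda>s. h (s / \<epsilon> k)) has_real_derivative h' (s / \<epsilon> k) / \<epsilon> k) (at s)" for s
    proof -
      have "((\<lambda>s. s / \<epsilon> k) has_real_derivative 1 / \<epsilon> k) (at s)" using \<epsilon>[of k] by (auto intro!: derivative_eq_intros)
      then show ?thesis using DERIV_chain2[of h "h' (s / \<epsilon> k)" "\<lambda>s. s / \<epsilon> k" s "1 / \<epsilon> k" UNIV] h(1) by simp
    qed
    moreover have "continuous_on UNIV (\<lambda>s. h' (s / \<epsilon> k) / \<epsilon> k)"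
      using \<epsilon>[of k] by (intro continuous_intros continuous_on_compose2[OF h(2)]) auto
    ultimately have "(\<integral>x. (q x)\<^sup>2 * h (snd x / \<epsilon> k) * f x - 4 * q x * h (snd x / \<epsilon> k) * (x \<bullet> W x)
       + (q x)\<^sup>2 * (h' (snd x / \<epsilon> k) / \<epsilon> k) * snd (W x) \<partial>lborel) = 0"
      using \<epsilon>[of k] h(3,4) W
      by (intro cutoff_divergence_integral[OF der D _ f(2) r \<epsilon>[of k]])
         (auto simp: q_def intro: continuous_on_subset)
    moreover have "(q x)\<^sup>2 * h (snd x / \<epsilon> k) * f x - 4 * q x * h (snd x / \<epsilon> k) * (x \<bullet> W x)
       + (q x)\<^sup>2 * (h' (snd x / \<epsilon> k) / \<epsilon> k) * snd (W x) = A k x + B k x" for x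
    proof (cases "x \<in> K")
      case True
      then have "(norm x)\<^sup>2 \<le> r\<^sup>2" by (intro power_mono) (auto simp: K_def)
      then have qx: "q x = r\<^sup>2 - x \<bullet> x" by (simp add: q_def dot_square_norm)
      show ?thesis unfolding qx A_def B_def YK_def Y_def using True by (simp add: algebra_simps)
    next
      case False
      have "q x = 0 \<or> snd x < 0"
      proof (cases "norm x \<le> r")
        case False
        then have "r\<^sup>2 \<le> (norm x)\<^sup>2" using r by (intro power_mono) auto
        then show ?thesis by (simp add: q_def dot_square_norm)
      qed (use False in \<open>auto simp: K_def\<close>)
      moreover have "snd x / \<epsilon> k \<le> 1" if "snd x < 0"
        using that \<epsilon>[of k] by (simp add: field_simps)
      ultimately show ?thesis using False h(3,4) by (auto simp: A_def B_def YK_def)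
    qed
    ultimately show ?thesis by simp
  qed
  have dom: "norm (A k x) \<le> 3 * \<bar>YK x\<bar>" for k x
    unfolding A_def using mult_right_mono[OF h(7), of "\<bar>YK x\<bar>"] by (simp add: abs_mult)
  have [measurable]: "A k \<in> borel_measurable borel" for k
  proof -
    have "continuous_on UNIV (\<lambda>x::(real ^ 'm) \<times> real. h (snd x / \<epsilon> k))"
      using \<epsilon>[of k] by (intro continuous_on_compose2[OF cont_h] continuous_intros) auto
    then have [measurable]: "(\<lambda>x::(real ^ 'm) \<times> real. h (snd x / \<epsilon> k)) \<in> borel_measurable borel"
      by (rule borel_measurable_continuous_onI)
    show ?thesis unfolding A_def by measurable
  qed
  have A_int: "integrable lborel (A k)" for k
    by (rule Bochner_Integration.integrable_bound[of _ "\<lambda>x. 3 * \<bar>YK x\<bar>"])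
       (use YK dom in auto)
  have B_int: "integrable lborel (B k)" for k
    unfolding B_def q_def
    by (intro borel_integrable_compact K continuous_intros WK continuous_on_compose2[OF h(2)])
       (use \<epsilon>[of k] in auto)
  have "(\<lambda>k. integral\<^sup>L lborel (A k)) \<longlonglongrightarrow> (\<integral>x. indicator U x *\<^sub>R YK x \<partial>lborel)"
  proof (rule integral_dominated_convergence[of _ _ _ "\<lambda>x. 3 * \<bar>YK x\<bar>"])
    show "AE x in lborel. (\<lambda>k. A k x) \<longlonglongrightarrow> indicator U x *\<^sub>R YK x"
    proof (rule AE_I2)
      fix x
      show "(\<lambda>k. A k x) \<longlonglongrightarrow> indicator U x *\<^sub>R YK x"
      proof (cases "snd x > 0")
        case True
        have "\<forall>\<^sub>F k in sequentially. \<epsilon> k < snd x / 2"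
          using True by (intro order_tendstoD[OF \<epsilon>_lim]) auto
        then have "\<forall>\<^sub>F k in sequentially. A k x = indicator U x *\<^sub>R YK x"
        proof eventually_elim
          case (elim k)
          then have "snd x / \<epsilon> k \<ge> 2" using \<epsilon>[of k] by (simp add: field_simps)
          then show ?case using True h(5) by (simp add: A_def U_def)
        qed
        then show ?thesis by (rule tendsto_eventually)
      next
        case False
        then have "snd x / \<epsilon> k \<le> 1" for k
          using \<epsilon>[of k] by (intro order_trans[OF divide_nonpos_pos]) auto
        then have "A k x = 0" for k using h(3) by (simp add: A_def)
        then show ?thesis using False by (simp add: U_def)
      qed
    qed
  qed (use YK dom in auto)
  moreover have "(\<lambda>k. integral\<^sup>L lborel (A k)) \<longlonglongrightarrow> 0"
  proof -
    have "(\<lambda>k. integral\<^sup>L lborel (B k)) \<longlonglongrightarrow> 0"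
    proof (rule tendstoI)
      fix e :: real assume "e > 0"
      define C where "C = measure lborel (cbox (- One) (One :: real ^ 'm))"
      have "C \<ge> 0" unfolding C_def by (rule measure_nonneg)
      \<comment> \<open>The slab over the cube has volume \<open>C * (2 * \<epsilon> k)\<close>, so
        the layer term is at most
        \<open>4 / \<epsilon> k * \<delta> * (C * (2 * \<epsilon> k))\<close>, that is
        \<open>8 * C * \<delta>\<close>, which lies below \<open>e\<close>.\<close>
      define \<delta> where "\<delta> = e / (8 * C + 1)"
      have "\<delta> > 0" using \<open>e > 0\<close> \<open>C \<ge> 0\<close> by (simp add: \<delta>_def)
      have "uniformly_continuous_on K (\<lambda>x. snd (W x))"
        by (intro compact_uniformly_continuous K continuous_intros WK)
      then obtain d where d: "d > 0"
          "\<And>x y. x \<in> K \<Longrightarrow> y \<in> K \<Longrightarrow> dist y x < d \<Longrightarrow> dist (snd (W y)) (snd (W x)) < \<delta>"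
        unfolding uniformly_continuous_on_def using \<open>\<delta> > 0\<close> by metis
      \<comment> \<open>Compare with the point of the flat part vertically below, where the normal
        component is 0.\<close>
      have small: "\<bar>snd (W x)\<bar> \<le> \<delta>" if x: "x \<in> K" "snd x < d" for x
      proof -
        let ?y = "(fst x, 0) :: (real ^ 'm) \<times> real"
        have "norm ?y \<le> norm x" by (simp add: norm_prod_def)
        then have y: "?y \<in> K" "?y \<in> flat_ball" using x r by (auto simp: K_def flat_ball_def)
        have "dist x ?y = \<bar>snd x\<bar>" by (simp add: dist_prod_def dist_real_def prod_eq_iff)
        then have "dist (snd (W x)) (snd (W ?y)) < \<delta>" using x y by (intro d) (auto simp: K_def)
        then show ?thesis using flat[OF y(2)] by simp
      qed
      \<comment> \<open>\<open>h'\<close> vanishes beyond 2, so the layer reaches up to height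
        \<open>2 * \<epsilon> k\<close>, which has to stay below \<open>d\<close>.\<close>
      have "\<forall>\<^sub>F k in sequentially. \<epsilon> k < d / 2"
        using \<open>d > 0\<close> by (intro order_tendstoD[OF \<epsilon>_lim]) auto
      then show "\<forall>\<^sub>F k in sequentially. dist (integral\<^sup>L lborel (B k)) 0 < e"
      proof eventually_elim
        case (elim k)
        define S where "S = cbox (- One, 0) ((One, 2 * \<epsilon> k) :: (real ^ 'm) \<times> real)"
        have bd: "\<bar>B k x\<bar> \<le> 4 / \<epsilon> k * \<delta> * indicator S x" for x
        proof (cases "x \<in> K \<and> snd x \<le> 2 * \<epsilon> k")
          case True
          have "norm (fst x) \<le> 1" using True r norm_fst_le[of "fst x" "snd x"] by (auto simp: K_def)
          then have "\<bar>fst x \<bullet> i\<bar> \<le> 1" if "i \<in> Basis" for i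
            using Basis_le_norm[OF that, of "fst x"] by linarith
          then have "x \<in> S" using True
            by (cases x) (auto simp: S_def K_def cbox_Pair_eq mem_box abs_le_iff minus_le_iff)
          have "0 \<le> q x" "q x \<le> 1"
            using r power_le_one[of r 2] inner_ge_zero[of x] by (auto simp: q_def max_def simp del: inner_ge_zero)
          then have "(q x)\<^sup>2 \<le> 1" by (simp add: power_le_one)
          moreover have "\<bar>h' (snd x / \<epsilon> k) / \<epsilon> k\<bar> \<le> 4 / \<epsilon> k"
            using h(8)[of "snd x / \<epsilon> k"] \<epsilon>[of k] by (simp add: divide_right_mono)
          moreover have "\<bar>snd (W x)\<bar> \<le> \<delta>" using True elim by (intro small) auto
          ultimately have "(q x)\<^sup>2 * \<bar>h' (snd x / \<epsilon> k) / \<epsilon> k\<bar> * \<bar>snd (W x)\<bar> \<le> 1 * (4 / \<epsilon> k) * \<delta>"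
            by (intro mult_mono) (use \<open>\<delta> > 0\<close> \<epsilon>[of k] in auto)
          then show ?thesis using True \<open>x \<in> S\<close> by (simp add: B_def abs_mult)
        next
          case False
          then have "B k x = 0"
            using h(6)[of "snd x / \<epsilon> k"] \<epsilon>[of k] by (auto simp: B_def indicator_def field_simps)
          then show ?thesis using \<open>\<delta> > 0\<close> \<epsilon>[of k] by simp
        qed
        have "\<bar>integral\<^sup>L lborel (B k)\<bar> \<le> (\<integral>x. \<bar>B k x\<bar> \<partial>lborel)" by (rule integral_abs_bound)
        also have "\<dots> \<le> (\<integral>x. 4 / \<epsilon> k * \<delta> * indicator S x \<partial>lborel)"
          using emeasure_lborel_cbox_finite[of "(- One, 0) :: (real ^ 'm) \<times> real"]
          by (intro integral_mono bd) (auto intro!: integrable_abs B_int integrable_mult_right simp: S_def)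
        also have "\<dots> = 4 / \<epsilon> k * \<delta> * measure lborel S" by (simp add: S_def)
        also have "measure lborel S = C * (2 * \<epsilon> k)"
          unfolding S_def C_def content_Pair using \<epsilon>[of k] by simp
        also have "4 / \<epsilon> k * \<delta> * (C * (2 * \<epsilon> k)) = 8 * C * \<delta>" using \<epsilon>[of k] by simp
        also have "\<dots> < (8 * C + 1) * \<delta>" using \<open>\<delta> > 0\<close> by simp
        also have "\<dots> = e" using \<open>C \<ge> 0\<close> by (simp add: \<delta>_def)
        finally show ?case by simp
      qed
    qed
    moreover have "integral\<^sup>L lborel (A k) = - integral\<^sup>L lborel (B k)" for k
      using AB[of k] A_int B_int by (simp add: Bochner_Integration.integral_add)
    ultimately show ?thesis using tendsto_minus by fastforce
  qed
  ultimately have "(\<integral>x. indicator U x *\<^sub>R YK x \<partial>lborel) = 0" by (rule LIMSEQ_unique)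
  then show "(LINT x:cball 0 r \<inter> {x. snd x > 0}|lborel. Y x) = 0"
    unfolding set_lebesgue_integral_def ind .
qed

text \<open>Composition with this map extends a function evenly from the upper half, flat part
  included, to the whole ball. The result is continuous even for expressions in
  \<open>grad u\<close>.\<close>

definition fold_up :: "(real ^ 'm::finite) \<times> real \<Rightarrow> (real ^ 'm) \<times> real" where
  "fold_up x = (fst x, \<bar>snd x\<bar>)"

lemma inner_fold_up [simp]: "fold_up x \<bullet> fold_up x = x \<bullet> x"
  by (simp add: fold_up_def inner_prod_def)

lemma norm_fold_up [simp]: "norm (fold_up x) = norm x"
  by (simp add: fold_up_def norm_prod_def)

lemma fold_up_in: "x \<in> ball 0 1 \<Longrightarrow> fold_up x \<in> upper_ball \<union> flat_ball"
  by (auto simp: fold_up_def upper_flat_eq norm_prod_def)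

lemma continuous_on_fold_up:
  assumes "continuous_on (upper_ball \<union> flat_ball) f"
  shows "continuous_on (ball 0 1) (\<lambda>x. f (fold_up x))"
proof (rule continuous_on_compose2[OF assms])
  show "continuous_on (ball 0 1) fold_up"
    unfolding fold_up_def[abs_def] by (intro continuous_intros)
qed (use fold_up_in in blast)

text \<open>The half ball and its mirror image fill the ball up to the null set
  \<open>snd x = 0\<close>. Vanishing on the sphere reconciles the closed ball in the hypotheses
  with the open ball in the conclusion.\<close>

lemma integral_ball_fold_up_eq_0:
  fixes Y :: "(real ^ 'm::finite) \<times> real \<Rightarrow> real"
  assumes int: "set_integrable lborel (cball 0 r \<inter> {x. snd x > 0}) Y"
    and 0: "(LINT x:cball 0 r \<inter> {x. snd x > 0}|lborel. Y x) = 0"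
    and Y: "continuous_on (upper_ball \<union> flat_ball) Y" and r: "r < 1"
    and sphere: "\<And>x. norm x = r \<Longrightarrow> Y x = 0"
  shows "(LINT x:ball 0 r|lborel. Y (fold_up x)) = 0"
proof -
  let ?H = "cball 0 r \<inter> {x :: (real ^ 'm) \<times> real. snd x > 0}"
  define k where "k = (\<lambda>x. indicator ?H x *\<^sub>R Y x)"
  have k: "integrable lborel k" using int by (simp add: k_def set_integrable_def)
  have [measurable]: "k \<in> borel_measurable borel" using borel_measurable_integrable[OF k] by simp
  have k0: "integral\<^sup>L lborel k = 0" using 0 by (simp add: k_def set_lebesgue_integral_def)
  note rho = integral_reflect_snd[of k]
  have "(LINT x:ball 0 r|lborel. Y (fold_up x)) = (\<integral>x. k x + k (fst x, - snd x) \<partial>lborel)"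
    unfolding set_lebesgue_integral_def
  proof (rule integral_cong_AE)
    show "(\<lambda>x. indicator (ball 0 r) x *\<^sub>R Y (fold_up x)) \<in> borel_measurable lborel"
      using set_integrable_ball[OF continuous_on_fold_up[OF Y] r]
      by (simp add: set_integrable_def borel_measurable_integrable)
    show "(\<lambda>x. k x + k (fst x, - snd x)) \<in> borel_measurable lborel"
      using k rho by (intro borel_measurable_integrable Bochner_Integration.integrable_add) auto
    show "AE x in lborel. indicator (ball 0 r) x *\<^sub>R Y (fold_up x) = k x + k (fst x, - snd x)"
      using AE_snd_neq_0
    proof eventually_elim
      case (elim x)
      have n: "norm (fst x, - snd x) = norm x" by (simp add: norm_prod_def)
      show ?case
      proof (cases "snd x > 0")
        case True
        then show ?thesis using sphere[of x] by (auto simp: k_def indicator_def fold_up_def n)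
      next
        case False
        then show ?thesis using sphere[of "(fst x, - snd x)"] elim
          by (auto simp: k_def indicator_def fold_up_def n)
      qed
    qed
  qed
  also have "\<dots> = 0" using k rho k0 by (subst Bochner_Integration.integral_add) auto
  finally show ?thesis .
qed

text \<open>Since \<open>g\<close> and \<open>c * f\<close> are compared on the sphere only, this
  pulls out powers of \<open>x \<bullet> x\<close>, and also serves as congruence rule
  (\<open>c = 1\<close>) and as vanishing criterion (\<open>c = 0\<close>).\<close>

lemma sphere_integral_mult:
  assumes "\<And>x. norm x = r \<Longrightarrow> g x = c * f x"
  shows "(LINT x:sphere 0 r|M. g x) = c * (LINT x:sphere 0 r|M. (f x :: real))"
proof -
  have "(LINT x:sphere 0 r|M. g x) = (LINT x:sphere 0 r|M. c * f x)"
    unfolding set_lebesgue_integral_def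
    by (intro Bochner_Integration.integral_cong) (auto simp: indicator_def assms)
  then show ?thesis by (simp add: set_lebesgue_integral_def mult.left_commute)
qed

text \<open>The weight \<open>(r\<^sup>2 - \<bar>x\<bar>\<^sup>2)\<^sup>2\<close> makes all boundary terms on the sphere vanish; the flux through
  the sphere is recovered by differentiating the weighted identity twice in \<open>r\<close>.\<close>

lemma folded_divergence_theorem:
  fixes W :: "(real ^ 'm::finite) \<times> real \<Rightarrow> (real ^ 'm) \<times> real"
  assumes der: "\<And>b x. b \<in> Basis \<Longrightarrow> x \<in> upper_ball \<Longrightarrow>
        ((\<lambda>t. W (x + t *\<^sub>R b) \<bullet> b) has_real_derivative D b x) (at 0)"
    and D: "\<And>b. b \<in> Basis \<Longrightarrow> continuous_on upper_ball (D b)"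
    and W: "continuous_on (upper_ball \<union> flat_ball) W"
    and f: "continuous_on (upper_ball \<union> flat_ball) f" "\<And>x. x \<in> upper_ball \<Longrightarrow> f x = (\<Sum>b\<in>Basis. D b x)"
    and flat: "\<And>x. x \<in> flat_ball \<Longrightarrow> snd (W x) = 0"
    and r: "0 < r" "r < 1"
  shows "r * (LINT x:ball 0 r|lborel. f (fold_up x)) =
    (LINT x:sphere 0 r|sphere_measure r. fold_up x \<bullet> W (fold_up x))"
proof -
  define a where "a = (\<lambda>x. f (fold_up x))"
  define w where "w = (\<lambda>x. fold_up x \<bullet> W (fold_up x))"
  have ac: "continuous_on (ball 0 1) a" unfolding a_def by (rule continuous_on_fold_up[OF f(1)])
  have "continuous_on (upper_ball \<union> flat_ball) (\<lambda>x. x \<bullet> W x)" by (intro continuous_intros W)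
  then have wc: "continuous_on (ball 0 1) w" unfolding w_def by (rule continuous_on_fold_up)
  \<comment> \<open>The weight \<open>(s\<^sup>2 - x \<bullet> x)\<^sup>2\<close> itself depends on
    \<open>s\<close>; expanding it into moments leaves integrands free of \<open>s\<close>, whose
    ball integrals can be differentiated in the radius.\<close>
  define A where "A = (\<lambda>s. LINT x:ball 0 s|lborel. a x)"
  define A2 where "A2 = (\<lambda>s. LINT x:ball 0 s|lborel. (x \<bullet> x) * a x)"
  define A4 where "A4 = (\<lambda>s. LINT x:ball 0 s|lborel. (x \<bullet> x)\<^sup>2 * a x)"
  define V where "V = (\<lambda>s. LINT x:ball 0 s|lborel. w x)"
  define V2 where "V2 = (\<lambda>s. LINT x:ball 0 s|lborel. (x \<bullet> x) * w x)"
  define Sa where "Sa = (\<lambda>s. LINT x:sphere 0 s|sphere_measure s. a x)"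
  define Sw where "Sw = (\<lambda>s. LINT x:sphere 0 s|sphere_measure s. w x)"
  have conts: "continuous_on (ball 0 1) (\<lambda>x. (x \<bullet> x) * a x)" "continuous_on (ball 0 1) (\<lambda>x. (x \<bullet> x)\<^sup>2 * a x)"
    "continuous_on (ball 0 1) (\<lambda>x. (x \<bullet> x) * w x)"
    by (intro continuous_intros ac wc)+
  have derivs: "(A has_real_derivative Sa s) (at s)" "(A2 has_real_derivative s\<^sup>2 * Sa s) (at s)"
     "(A4 has_real_derivative (s\<^sup>2)\<^sup>2 * Sa s) (at s)" "(V has_real_derivative Sw s) (at s)"
     "(V2 has_real_derivative s\<^sup>2 * Sw s) (at s)" if s: "0 < s" "s < 1" for s
  proof -
    note L = has_real_derivative_ball_integral[OF _ s]
    show "(A has_real_derivative Sa s) (at s)" "(V has_real_derivative Sw s) (at s)"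
      unfolding A_def Sa_def V_def Sw_def by (intro L ac wc)+
    show "(A2 has_real_derivative s\<^sup>2 * Sa s) (at s)"
      unfolding A2_def Sa_def
      by (rule DERIV_cong[OF L[OF conts(1)] sphere_integral_mult]) (simp add: dot_square_norm)
    show "(A4 has_real_derivative (s\<^sup>2)\<^sup>2 * Sa s) (at s)"
      unfolding A4_def Sa_def
      by (rule DERIV_cong[OF L[OF conts(2)] sphere_integral_mult]) (simp add: dot_square_norm)
    show "(V2 has_real_derivative s\<^sup>2 * Sw s) (at s)"
      unfolding V2_def Sw_def
      by (rule DERIV_cong[OF L[OF conts(3)] sphere_integral_mult]) (simp add: dot_square_norm)
  qed
  have I0: "(s\<^sup>2)\<^sup>2 * A s - 2 * s\<^sup>2 * A2 s + A4 s - 4 * (s\<^sup>2 * V s - V2 s) = 0" if s: "0 < s" "s < 1" for s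
  proof -
    define Y where "Y = (\<lambda>x. (s\<^sup>2 - x \<bullet> x)\<^sup>2 * f x - 4 * (s\<^sup>2 - x \<bullet> x) * (x \<bullet> W x))"
    have Y: "continuous_on (upper_ball \<union> flat_ball) Y"
      unfolding Y_def by (intro continuous_intros W f)
    note H = half_ball_divergence[OF der D W f flat s, folded Y_def]
    have "(LINT x:ball 0 s|lborel. Y (fold_up x)) = 0"
      by (rule integral_ball_fold_up_eq_0[OF H Y s(2)]) (simp_all add: Y_def dot_square_norm)
    moreover have "Y (fold_up x) = (s\<^sup>2)\<^sup>2 * a x - 2 * s\<^sup>2 * ((x \<bullet> x) * a x) + (x \<bullet> x)\<^sup>2 * a x
       - 4 * (s\<^sup>2 * w x - (x \<bullet> x) * w x)" for x
      by (simp add: Y_def a_def w_def power2_eq_square algebra_simps)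
    moreover have "(LINT x:ball 0 s|lborel. (s\<^sup>2)\<^sup>2 * a x - 2 * s\<^sup>2 * ((x \<bullet> x) * a x) + (x \<bullet> x)\<^sup>2 * a x
       - 4 * (s\<^sup>2 * w x - (x \<bullet> x) * w x)) = (s\<^sup>2)\<^sup>2 * A s - 2 * s\<^sup>2 * A2 s + A4 s - 4 * (s\<^sup>2 * V s - V2 s)"
    proof -
      note i = set_integrable_ball[OF ac s(2)] set_integrable_ball[OF wc s(2)] conts[THEN set_integrable_ball, OF s(2)]
      show ?thesis unfolding A_def A2_def A4_def V_def V2_def
        using i by (simp add: set_integral_add(2) set_integral_diff(2) set_integral_diff(1) set_integral_add(1))
    qed
    ultimately show ?thesis by simp
  qed
  \<comment> \<open>Differentiating \<open>I0\<close> gives \<open>4 * s\<close> times this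
    expression: the terms with \<open>Sa\<close> and \<open>Sw\<close> cancel because both weights
    vanish on the sphere.\<close>
  have I1: "s\<^sup>2 * A s - A2 s - 2 * V s = 0" if s: "0 < s" "s < 1" for s
  proof -
    have "((\<lambda>s. (s\<^sup>2)\<^sup>2 * A s - 2 * s\<^sup>2 * A2 s + A4 s - 4 * (s\<^sup>2 * V s - V2 s)) has_real_derivative
        4 * s * (s\<^sup>2 * A s - A2 s - 2 * V s)) (at s)"
      by (rule derivative_eq_intros derivs s refl)+ (simp add: power2_eq_square algebra_simps)
    moreover have "((\<lambda>s. (s\<^sup>2)\<^sup>2 * A s - 2 * s\<^sup>2 * A2 s + A4 s - 4 * (s\<^sup>2 * V s - V2 s)) has_real_derivative 0) (at s)"
      by (rule has_field_derivative_transform_within_open[of "\<lambda>_. 0" _ _ "{0<..<1}"]) (use I0 s in auto)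
    ultimately show ?thesis using DERIV_unique s by fastforce
  qed
  \<comment> \<open>In the second differentiation only the weight of \<open>a\<close> still vanishes
    on the sphere; the weight of \<open>w\<close> is now constant, so the flux \<open>Sw r\<close>
    survives.\<close>
  have "((\<lambda>s. s\<^sup>2 * A s - A2 s - 2 * V s) has_real_derivative 2 * (r * A r - Sw r)) (at r)"
    by (rule derivative_eq_intros derivs r refl)+ (simp add: power2_eq_square algebra_simps)
  moreover have "((\<lambda>s. s\<^sup>2 * A s - A2 s - 2 * V s) has_real_derivative 0) (at r)"
    by (rule has_field_derivative_transform_within_open[of "\<lambda>_. 0" _ _ "{0<..<1}"]) (use I1 r in auto)
  ultimately have "r * A r = Sw r" using DERIV_unique by fastforce
  then show ?thesis by (simp add: A_def Sw_def a_def w_def)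
qed

section \<open>Signorini solutions\<close>

lemma pderiv_dir_eq_inner_gradient:
  assumes "f differentiable (at x)"
  shows "pderiv_dir v f x = gradient f x \<bullet> v"
proof -
  interpret linear "frechet_derivative f (at x)" by (rule linear_frechet_derivative[OF assms])
  have "pderiv_dir v f x = frechet_derivative f (at x) (\<Sum>b\<in>Basis. (v \<bullet> b) *\<^sub>R b)"
    by (simp add: pderiv_dir_def euclidean_representation)
  also have "\<dots> = gradient f x \<bullet> v"
    unfolding sum scale by (simp add: gradient_def inner_sum_left inner_commute[of v] pderiv_dir_def mult.commute)
  finally show ?thesis .
qed

lemma gradient_inner_Basis [simp]: "b \<in> Basis \<Longrightarrow> gradient f x \<bullet> b = pderiv_dir b f x"
  by (simp add: gradient_def)

lemma signoriniD:
  assumes "u \<in> signorini"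
  shows "continuous_on (upper_ball \<union> flat_ball) u" "C2_on u upper_ball"
    "\<And>x. x \<in> upper_ball \<Longrightarrow> laplacian u x = 0"
    "\<And>x. x \<in> flat_ball \<Longrightarrow> u x \<ge> 0" "\<And>x. x \<in> flat_ball \<Longrightarrow> u x * snd (grad u x) = 0"
    "\<And>x. x \<in> ball 0 1 \<Longrightarrow> u (fst x, - snd x) = u x"
    "\<And>x. x \<in> upper_ball \<Longrightarrow> u differentiable (at x)"
    "\<And>b x. b \<in> Basis \<Longrightarrow> x \<in> upper_ball \<Longrightarrow> pderiv_dir b u differentiable (at x)"
    "\<And>b c. b \<in> Basis \<Longrightarrow> c \<in> Basis \<Longrightarrow> continuous_on upper_ball (pderiv_dir c (pderiv_dir b u))"
  using assms by (auto simp: signorini_def C1_holder_loc_def C2_on_def)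

lemma grad_upper: "x \<in> upper_ball \<Longrightarrow> grad u x = gradient u x"
  by (auto simp: grad_def upper_ball_def)

text \<open>Regularity is given on compact subsets. The closed half ball whose radius lies halfway
  between \<open>norm x\<close> and 1 is a relative neighbourhood of \<open>x\<close>, so continuity
  there is enough.\<close>

lemma continuous_on_upper_flatI:
  fixes f :: "(real ^ 'm::finite) \<times> real \<Rightarrow> 'b::topological_space"
  assumes "\<And>\<rho>. 0 < \<rho> \<Longrightarrow> \<rho> < 1 \<Longrightarrow> continuous_on (cball 0 \<rho> \<inter> {x. snd x \<ge> 0}) f"
  shows "continuous_on (upper_ball \<union> flat_ball) f"
  unfolding continuous_on_eq_continuous_within
proof
  fix x :: "(real ^ 'm) \<times> real" assume x: "x \<in> upper_ball \<union> flat_ball"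
  define \<rho> where "\<rho> = (norm x + 1) / 2"
  have \<rho>: "0 < \<rho>" "norm x < \<rho>" "\<rho> < 1" using x by (auto simp: \<rho>_def upper_flat_eq add_nonneg_pos)
  let ?K = "cball 0 \<rho> \<inter> {x :: (real ^ 'm) \<times> real. snd x \<ge> 0}"
  have "continuous (at x within ?K) f"
    using assms[of \<rho>] \<rho> x by (auto simp: continuous_on_eq_continuous_within upper_flat_eq)
  moreover have "at x within ?K = at x within (upper_ball \<union> flat_ball)"
    by (rule at_within_nhd[of _ "ball 0 \<rho>"]) (use \<rho> x in \<open>auto simp: upper_flat_eq\<close>)
  ultimately show "continuous (at x within (upper_ball \<union> flat_ball)) f" by simp
qed

text \<open>The Hoelder extension \<open>G\<close> of the gradient is continuous on closed half
  balls, and its value on the flat part is the limit from above, which is how \<open>grad\<close> is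
  defined there.\<close>

lemma continuous_on_grad:
  fixes u :: "(real ^ 'm::finite) \<times> real \<Rightarrow> real"
  assumes "u \<in> signorini"
  shows "continuous_on (upper_ball \<union> flat_ball) (grad u)"
proof -
  obtain \<alpha> where \<alpha>: "\<alpha> > 0" "C1_holder_loc \<alpha> u"
    using assms unfolding signorini_def by blast
  from \<alpha>(2) obtain G where G': "\<forall>x\<in>upper_ball. G x = gradient u x"
    and hoelder: "\<forall>K. compact K \<and> K \<subseteq> upper_ball \<union> flat_ball \<longrightarrow>
           (\<exists>C. \<forall>x\<in>K. \<forall>y\<in>K. norm (G x - G y) \<le> C * dist x y powr \<alpha>)"
    unfolding C1_holder_loc_def by blast
  have G: "G x = gradient u x" if "x \<in> upper_ball" for x using G' that by blast
  have G_cont: "continuous_on (upper_ball \<union> flat_ball) G"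
  proof (rule continuous_on_upper_flatI)
    fix \<rho> :: real assume \<rho>: "0 < \<rho>" "\<rho> < 1"
    let ?K = "cball 0 \<rho> \<inter> {x :: (real ^ 'm) \<times> real. snd x \<ge> 0}"
    have "compact ?K"
      by (intro compact_Int_closed compact_cball closed_Collect_le continuous_intros)
    moreover have "?K \<subseteq> upper_ball \<union> flat_ball" using \<rho> by (auto simp: upper_flat_eq)
    ultimately obtain C where C: "\<And>x y. x \<in> ?K \<Longrightarrow> y \<in> ?K \<Longrightarrow> norm (G x - G y) \<le> C * dist x y powr \<alpha>"
      using hoelder by meson
    show "continuous_on ?K G"
      unfolding continuous_on_def
    proof
      fix x assume x: "x \<in> ?K"
      have "((\<lambda>y. dist y x powr \<alpha>) \<longlongrightarrow> 0) (at x within ?K)"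
        using \<alpha> by (intro tendsto_zero_powrI[of _ _ "\<lambda>_. \<alpha>" \<alpha>] tendsto_const) (auto intro!: tendsto_eq_intros)
      then have "((\<lambda>y. C * dist y x powr \<alpha>) \<longlongrightarrow> 0) (at x within ?K)"
        by (rule tendsto_mult_right_zero)
      then have "((\<lambda>y. G y - G x) \<longlongrightarrow> 0) (at x within ?K)"
        by (rule Lim_null_comparison[rotated])
           (use C x in \<open>auto simp: eventually_at_filter intro!: always_eventually\<close>)
      then show "(G \<longlongrightarrow> G x) (at x within ?K)" by (rule LIM_zero_cancel)
    qed
  qed
  have "grad u x = G x" if x: "x \<in> upper_ball \<union> flat_ball" for x
  proof (cases "x \<in> upper_ball")
    case False
    then have x0: "x \<in> flat_ball" using x by auto
    have "(G \<longlongrightarrow> G x) (at x within upper_ball)"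
      using G_cont x unfolding continuous_on_def by (auto intro: tendsto_within_subset)
    then have "(gradient u \<longlongrightarrow> G x) (at x within upper_ball)"
      by (rule Lim_transform_eventually) (auto simp: eventually_at_filter G)
    moreover have "at x within upper_ball = at x within {y. snd y > 0}"
      by (rule at_within_nhd[of _ "ball 0 1"]) (use x0 in \<open>auto simp: upper_ball_def flat_ball_def\<close>)
    ultimately have lim: "(gradient u \<longlongrightarrow> G x) (at x within {y. snd y > 0})" by simp
    \<comment> \<open>Convergence determines \<open>Lim\<close> only for a nontrivial filter, so
      \<open>x\<close> must be a limit point of the open half space.\<close>
    have "x islimpt {y. snd y > 0}"
      unfolding islimpt_approachable
    proof (intro allI impI)
      fix e :: real assume "e > 0"
      then show "\<exists>y\<in>{y. snd y > 0}. y \<noteq> x \<and> dist y x < e"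
        using x0 by (intro bexI[of _ "(fst x, e / 2)"])
          (auto simp: flat_ball_def dist_prod_def prod_eq_iff)
    qed
    then have "Lim (at x within {y. snd y > 0}) (gradient u) = G x"
      by (intro tendsto_Lim lim) (simp add: trivial_limit_within)
    then show ?thesis using x0 by (simp add: grad_def flat_ball_def)
  qed (simp add: grad_upper G)
  then show ?thesis by (intro continuous_on_eq[OF G_cont]) simp
qed

text \<open>At a contact point, \<open>u \<ge> 0\<close> attains its minimum over the flat part, so its tangential
  derivatives vanish; these are limits of derivatives taken at height \<open>\<epsilon>\<close>.\<close>

lemma tangential_derivative_nonneg:
  fixes u :: "(real ^ 'm::finite) \<times> real \<Rightarrow> real"
  assumes u: "u \<in> signorini" and x: "x \<in> flat_ball" "u x = 0" and v: "snd v = 0"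
  shows "grad u x \<bullet> v \<ge> 0"
proof (rule ccontr)
  let ?S = "upper_ball \<union> flat_ball :: ((real ^ 'm) \<times> real) set"
  define L where "L = grad u x \<bullet> v"
  assume "\<not> grad u x \<bullet> v \<ge> 0"
  then have "L < 0" by (simp add: L_def)
  have "continuous_on ?S (\<lambda>y. grad u y \<bullet> v)" by (intro continuous_intros continuous_on_grad[OF u])
  then obtain d where d: "d > 0" "\<And>y. y \<in> ?S \<Longrightarrow> dist y x < d \<Longrightarrow> dist (grad u y \<bullet> v) L < - L / 2"
    unfolding continuous_on_iff L_def using x \<open>L < 0\<close>[unfolded L_def]
    by (metis (no_types, lifting) UnCI half_gt_zero neg_0_less_iff_less)
  define m where "m = min d (1 - norm x)"
  have m: "m > 0" "m \<le> d" "m \<le> 1 - norm x" using d x by (auto simp: m_def flat_ball_def)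
  \<comment> \<open>With this choice \<open>t * norm v\<close> is below \<open>m / 2\<close>, also
    for \<open>v = 0\<close> thanks to the \<open>+ 1\<close>; at heights below \<open>m / 2\<close>
    the whole segment remains within \<open>m\<close> of \<open>x\<close>.\<close>
  define t where "t = m / (2 * (norm v + 1))"
  have t: "t > 0" using m by (simp add: t_def add_nonneg_pos)
  have "t * norm v < m / 2"
  proof -
    have "t * norm v < t * (norm v + 1)" using t by simp
    also have "\<dots> = m / 2"
    proof -
      have "m / (2 * a) * a = m / 2" if "a \<noteq> 0" for a using that by simp
      moreover have "norm v + 1 \<noteq> 0" using norm_ge_zero[of v] by linarith
      ultimately show ?thesis unfolding t_def by blast
    qed
    finally show ?thesis .
  qed
  \<comment> \<open>\<open>p \<epsilon> \<tau>\<close> moves in direction \<open>v\<close> at height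
    \<open>\<epsilon>\<close>: the mean value theorem is applied at positive height, where
    \<open>u\<close> is differentiable, and continuity of \<open>u\<close> then lets
    \<open>\<epsilon>\<close> tend to 0.\<close>
  define p where "p = (\<lambda>\<epsilon> \<tau>. x + (0, \<epsilon>) + \<tau> *\<^sub>R v)"
  have p_near: "norm (p \<epsilon> \<tau> - x) < m" if "0 \<le> \<epsilon>" "\<epsilon> < m / 2" "0 \<le> \<tau>" "\<tau> \<le> t" for \<epsilon> \<tau>
  proof -
    have "norm (p \<epsilon> \<tau> - x) \<le> norm (0 :: real ^ 'm, \<epsilon>) + norm (\<tau> *\<^sub>R v)"
      using norm_triangle_ineq[of "(0, \<epsilon>)" "\<tau> *\<^sub>R v"] unfolding p_def by (simp add: add.assoc)
    also have "norm (\<tau> *\<^sub>R v) \<le> t * norm v" using that by (simp add: mult_right_mono)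
    finally show ?thesis using that \<open>t * norm v < m / 2\<close> by (simp add: norm_prod_def)
  qed
  have p_ball: "norm (p \<epsilon> \<tau>) < 1" if "0 \<le> \<epsilon>" "\<epsilon> < m / 2" "0 \<le> \<tau>" "\<tau> \<le> t" for \<epsilon> \<tau>
    using p_near[OF that] norm_triangle_sub[of "p \<epsilon> \<tau>" x] m by linarith
  have snd_p: "snd (p \<epsilon> \<tau>) = \<epsilon>" for \<epsilon> \<tau> using x v by (simp add: p_def flat_ball_def)
  \<comment> \<open>Within \<open>d\<close> of \<open>x\<close> the derivative along
    \<open>v\<close> differs from \<open>L < 0\<close> by less than \<open>- L / 2\<close>, hence is
    at most \<open>L / 2\<close>.\<close>
  have ineq: "u (p \<epsilon> t) \<le> u (p \<epsilon> 0) + t * (L / 2)" if \<epsilon>: "0 < \<epsilon>" "\<epsilon> < m / 2" for \<epsilon>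
  proof -
    have up: "p \<epsilon> \<tau> \<in> upper_ball" if "0 \<le> \<tau>" "\<tau> \<le> t" for \<tau>
      using p_ball[of \<epsilon> \<tau>] snd_p[of \<epsilon> \<tau>] \<epsilon> that by (simp add: upper_ball_def)
    have "((\<lambda>\<tau>. u (p \<epsilon> \<tau>)) has_real_derivative pderiv_dir v u (p \<epsilon> \<tau>)) (at \<tau>)" if "0 \<le> \<tau>" "\<tau> \<le> t" for \<tau>
      unfolding p_def by (intro has_real_derivative_along' signoriniD(7)[OF u] up[OF that, unfolded p_def])
    then obtain \<tau> where \<tau>: "0 < \<tau>" "\<tau> < t" "u (p \<epsilon> t) - u (p \<epsilon> 0) = (t - 0) * pderiv_dir v u (p \<epsilon> \<tau>)"
      using MVT2[of 0 t "\<lambda>\<tau>. u (p \<epsilon> \<tau>)" "\<lambda>\<tau>. pderiv_dir v u (p \<epsilon> \<tau>)"] t by blast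
    have U: "p \<epsilon> \<tau> \<in> upper_ball" using up \<tau> by simp
    have "dist (grad u (p \<epsilon> \<tau>) \<bullet> v) L < - L / 2"
      using U p_near[of \<epsilon> \<tau>] \<epsilon> \<tau> m by (intro d) (auto simp: dist_norm)
    moreover have "pderiv_dir v u (p \<epsilon> \<tau>) = grad u (p \<epsilon> \<tau>) \<bullet> v"
      unfolding grad_upper[OF U] by (rule pderiv_dir_eq_inner_gradient[OF signoriniD(7)[OF u U]])
    ultimately have "pderiv_dir v u (p \<epsilon> \<tau>) \<le> L / 2" by (simp add: dist_real_def)
    then have "t * pderiv_dir v u (p \<epsilon> \<tau>) \<le> t * (L / 2)" using t by (intro mult_left_mono) auto
    moreover have "u (p \<epsilon> t) - u (p \<epsilon> 0) = t * pderiv_dir v u (p \<epsilon> \<tau>)" using \<tau> by simp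
    ultimately show ?thesis by linarith
  qed
  have p_lim: "((\<lambda>\<epsilon>. u (p \<epsilon> \<tau>)) \<longlongrightarrow> u (p 0 \<tau>)) (at_right 0)" if \<tau>: "0 \<le> \<tau>" "\<tau> \<le> t" for \<tau>
  proof (rule continuous_on_tendsto_compose[OF signoriniD(1)[OF u]])
    have "((\<lambda>\<epsilon>. p \<epsilon> \<tau>) \<longlongrightarrow> p 0 \<tau>) (at 0)"
      unfolding p_def by (intro tendsto_intros)
    then show "((\<lambda>\<epsilon>. p \<epsilon> \<tau>) \<longlongrightarrow> p 0 \<tau>) (at_right 0)"
      by (rule filterlim_mono) (simp_all add: at_le)
    show "p 0 \<tau> \<in> ?S" using p_ball[of 0 \<tau>] snd_p[of 0 \<tau>] \<tau> m by (simp add: upper_flat_eq)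
    have "\<forall>\<^sub>F \<epsilon> in at_right 0. \<epsilon> \<in> {0<..<m / 2}"
      using m eventually_at_right_real[of 0 "m / 2"] by simp
    then show "\<forall>\<^sub>F \<epsilon> in at_right 0. p \<epsilon> \<tau> \<in> ?S"
      by eventually_elim (use p_ball snd_p \<tau> in \<open>auto simp: upper_flat_eq\<close>)
  qed
  have "u (p 0 t) \<le> u (p 0 0) + t * (L / 2)"
  proof (rule tendsto_le[of "at_right 0"])
    show "((\<lambda>\<epsilon>. u (p \<epsilon> 0) + t * (L / 2)) \<longlongrightarrow> u (p 0 0) + t * (L / 2)) (at_right 0)"
      by (intro tendsto_intros p_lim) (use t in auto)
    show "((\<lambda>\<epsilon>. u (p \<epsilon> t)) \<longlongrightarrow> u (p 0 t)) (at_right 0)" by (intro p_lim) (use t in auto)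
    have "\<forall>\<^sub>F \<epsilon> in at_right 0. \<epsilon> \<in> {0<..<m / 2}"
      using m eventually_at_right_real[of 0 "m / 2"] by simp
    then show "\<forall>\<^sub>F \<epsilon> in at_right 0. u (p \<epsilon> t) \<le> u (p \<epsilon> 0) + t * (L / 2)"
      by eventually_elim (use ineq in auto)
  qed simp
  moreover have "p 0 0 = x" by (simp add: p_def prod_eq_iff)
  moreover have "p 0 t \<in> flat_ball" using p_ball[of 0 t] snd_p[of 0 t] t m by (simp add: flat_ball_def)
  then have "u (p 0 t) \<ge> 0" by (rule signoriniD(4)[OF u])
  moreover have "t * (L / 2) < 0" using t \<open>L < 0\<close> by (simp add: mult_pos_neg)
  ultimately show False using x by simp
qed

text \<open>Up to the factor -2 this is the normal component on the flat part of the field behind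
  \<open>rellich_identity\<close>. There \<open>x\<close> is tangential: at a contact point the
  one-sided bounds for \<open>x\<close> and \<open>- x\<close> annihilate the radial derivative,
  elsewhere the normal derivative is 0.\<close>

lemma radial_times_normal_derivative_eq_0:
  fixes u :: "(real ^ 'm::finite) \<times> real \<Rightarrow> real"
  assumes u: "u \<in> signorini" and x: "x \<in> flat_ball"
  shows "(x \<bullet> grad u x) * snd (grad u x) = 0"
proof (cases "u x = 0")
  case True
  have "snd x = 0" using x by (simp add: flat_ball_def)
  then have "grad u x \<bullet> x \<ge> 0" "grad u x \<bullet> (- x) \<ge> 0"
    using tangential_derivative_nonneg[OF u x True, of x] tangential_derivative_nonneg[OF u x True, of "- x"] by auto
  then show ?thesis by (simp add: inner_commute)
qed (use signoriniD(5)[OF u x] in auto)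

section \<open>Behaviour of solutions under reflection\<close>

lemma gradient_reflect:
  fixes u :: "(real ^ 'm::finite) \<times> real \<Rightarrow> real"
  assumes u: "u \<in> signorini" and x: "norm x < 1" "snd x < 0"
  shows "gradient u x = (fst (gradient u (fold_up x)), - snd (gradient u (fold_up x)))"
proof -
  define \<rho> where "\<rho> = (\<lambda>x :: (real ^ 'm) \<times> real. (fst x, - snd x))"
  have \<rho>_lin: "bounded_linear \<rho>"
    unfolding \<rho>_def by (intro bounded_linear_Pair bounded_linear_fst bounded_linear_minus bounded_linear_snd)
  have \<rho>x: "fold_up x = \<rho> x" using x by (simp add: \<rho>_def fold_up_def)
  have up: "\<rho> x \<in> upper_ball" using x by (simp add: \<rho>_def upper_ball_def norm_prod_def)
  define D where "D = frechet_derivative u (at (\<rho> x))"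
  have diff: "u differentiable (at (\<rho> x))" by (rule signoriniD(7)[OF u up])
  then have "(u has_derivative D) (at (\<rho> x))" by (simp add: D_def frechet_derivative_works)
  then have "((\<lambda>y. u (\<rho> y)) has_derivative (\<lambda>h. D (\<rho> h))) (at x)"
    using diff_chain_at[OF bounded_linear_imp_has_derivative[OF \<rho>_lin]] by (simp add: o_def)
  then have "(u has_derivative (\<lambda>h. D (\<rho> h))) (at x)"
    by (rule has_derivative_transform_within_open[of _ _ _ UNIV "ball 0 1"])
       (use x signoriniD(6)[OF u] in \<open>auto simp: \<rho>_def\<close>)
  then have "frechet_derivative u (at x) = (\<lambda>h. D (\<rho> h))"
    by (rule frechet_derivative_at[symmetric])
  then have pd: "pderiv_dir b u x = pderiv_dir (\<rho> b) u (\<rho> x)" for b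
    by (simp add: pderiv_dir_def D_def)
  have "gradient u x \<bullet> b = \<rho> (gradient u (\<rho> x)) \<bullet> b" if "b \<in> Basis" for b
  proof -
    have "gradient u x \<bullet> b = pderiv_dir (\<rho> b) u (\<rho> x)"
      unfolding gradient_inner_Basis[OF that] by (rule pd)
    also have "\<dots> = gradient u (\<rho> x) \<bullet> \<rho> b" by (rule pderiv_dir_eq_inner_gradient[OF diff])
    also have "\<dots> = \<rho> (gradient u (\<rho> x)) \<bullet> b" by (simp add: \<rho>_def inner_prod_def)
    finally show ?thesis .
  qed
  then have "gradient u x = \<rho> (gradient u (\<rho> x))" by (rule euclidean_eqI)
  then show ?thesis unfolding \<rho>x by (simp only: \<rho>_def)
qed

text \<open>Reflection flips the last component of the gradient, which leaves its norm and its
  product with the equally reflected \<open>x\<close> unchanged. This turns folded identities into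
  identities for \<open>u\<close> on full balls and spheres.\<close>

lemma fold_up_invariance:
  fixes u :: "(real ^ 'm::finite) \<times> real \<Rightarrow> real"
  assumes u: "u \<in> signorini" and x: "norm x < 1"
  shows "u (fold_up x) = u x" "norm (grad u (fold_up x)) = norm (grad u x)"
    "fold_up x \<bullet> grad u (fold_up x) = x \<bullet> grad u x"
proof -
  have "u (fold_up x) = u x \<and> norm (grad u (fold_up x)) = norm (grad u x)
     \<and> fold_up x \<bullet> grad u (fold_up x) = x \<bullet> grad u x"
  proof (cases "snd x \<ge> 0")
    case False
    then have "grad u x = gradient u x" "grad u (fold_up x) = gradient u (fold_up x)"
      by (auto simp: grad_def fold_up_def)
    then show ?thesis
      using gradient_reflect[OF u x] signoriniD(6)[OF u, of x] False x
      by (auto simp: fold_up_def norm_prod_def inner_prod_def)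
  qed (simp add: fold_up_def)
  then show "u (fold_up x) = u x" "norm (grad u (fold_up x)) = norm (grad u x)"
    "fold_up x \<bullet> grad u (fold_up x) = x \<bullet> grad u x" by auto
qed

lemma set_integrable_sphere:
  fixes f :: "'a::euclidean_space \<Rightarrow> real"
  assumes f: "continuous_on (sphere 0 r) f"
  shows "set_integrable (sphere_measure r) (sphere 0 r) f"
proof -
  let ?g = "\<lambda>x. indicator (sphere 0 r) x *\<^sub>R f x"
  have g [measurable]: "?g \<in> borel_measurable borel"
    by (intro borel_measurable_continuous_on_indicator f) auto
  obtain M where M: "\<And>x. x \<in> sphere 0 r \<Longrightarrow> norm (f x) \<le> M"
    using compact_imp_bounded[OF compact_continuous_image[OF f compact_sphere]]
    unfolding bounded_iff by fastforce
  have "emeasure (distr (restrict_space lborel (ball 0 r)) borel (\<lambda>x::'a. (r / norm x) *\<^sub>R x)) (sphere 0 r) < \<infinity>"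
  proof -
    have p: "(\<lambda>x::'a. (r / norm x) *\<^sub>R x) \<in> measurable (restrict_space lborel (ball 0 r)) borel"
      by (intro measurable_restrict_space1) simp
    have "emeasure (distr (restrict_space lborel (ball 0 r)) borel (\<lambda>x::'a. (r / norm x) *\<^sub>R x)) (sphere 0 r)
        \<le> emeasure (restrict_space lborel (ball (0::'a) r)) (space (restrict_space lborel (ball (0::'a) r)))"
      by (simp only: emeasure_distr[OF p] borel_closed[OF closed_sphere] emeasure_space)
    also have "\<dots> = emeasure lborel (ball (0::'a) r)"
      by (subst emeasure_restrict_space) (auto simp: space_restrict_space)
    finally show ?thesis using emeasure_lborel_ball_finite order_le_less_trans by blast
  qed
  then have "emeasure (sphere_measure r) (sphere (0::'a) r) < \<infinity>"
    unfolding sphere_measure_def by (simp add: ennreal_mult_less_top)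
  moreover have "?g \<in> borel_measurable (sphere_measure r)"
    using g by (simp add: sphere_measure_def cong: measurable_cong_sets)
  moreover have "sphere 0 r \<in> sets (sphere_measure r)" by (simp add: sphere_measure_def)
  ultimately have "integrable (sphere_measure r) (\<lambda>x. indicator (sphere 0 r) x *\<^sub>R ?g x)"
    by (intro integrableI_bounded_set_indicator[where B = M]) (use M in auto)
  moreover have "indicator (sphere 0 r) x *\<^sub>R ?g x = ?g x" for x by (simp add: indicator_def)
  ultimately show ?thesis unfolding set_integrable_def by (simp only:)
qed

lemma eventually_upper_along:
  fixes x :: "(real ^ 'm::finite) \<times> real"
  assumes "x \<in> upper_ball"
  shows "\<forall>\<^sub>F t in nhds 0. x + t *\<^sub>R b \<in> upper_ball"
proof -
  have "((\<lambda>t. x + t *\<^sub>R b) \<longlongrightarrow> x + 0 *\<^sub>R b) (nhds 0)"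
    by (intro tendsto_intros filterlim_ident)
  then show ?thesis using assms open_upper_ball by (intro topological_tendstoD) auto
qed

lemma inner_deriv:
  fixes v w :: "real \<Rightarrow> 'a::real_inner"
  assumes "(v has_vector_derivative v') (at 0)" "(w has_vector_derivative w') (at 0)"
  shows "((\<lambda>t. v t \<bullet> w t) has_real_derivative v 0 \<bullet> w' + v' \<bullet> w 0) (at 0)"
  using bounded_bilinear.has_vector_derivative[OF bounded_bilinear_inner assms]
  by (simp add: has_real_derivative_iff_has_vector_derivative)

lemma line_deriv: "((\<lambda>t. x + t *\<^sub>R b) has_vector_derivative (b :: 'a::real_normed_vector)) (at 0)"
  by (auto intro!: derivative_eq_intros simp: has_vector_derivative_def)

section \<open>The Hessian and the three integral identities\<close>

context
  fixes u :: "(real ^ 'm::finite) \<times> real \<Rightarrow> real"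
  assumes u: "u \<in> signorini"
begin

text \<open>The Hessian applied to \<open>b\<close>, kept as a vector so that second-order terms
  become inner products.\<close>

definition hess :: "(real ^ 'm) \<times> real \<Rightarrow> (real ^ 'm) \<times> real \<Rightarrow> (real ^ 'm) \<times> real" where
  "hess b x = (\<Sum>c\<in>Basis. pderiv_dir b (pderiv_dir c u) x *\<^sub>R c)"

lemma hess_inner: "c \<in> Basis \<Longrightarrow> hess b x \<bullet> c = pderiv_dir b (pderiv_dir c u) x"
  by (simp add: hess_def)

lemma hess_cont: "b \<in> Basis \<Longrightarrow> continuous_on upper_ball (hess b)"
  unfolding hess_def by (intro continuous_intros signoriniD(9)[OF u])

lemma sum_hess: "x \<in> upper_ball \<Longrightarrow> (\<Sum>b\<in>Basis. hess b x \<bullet> b) = 0"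
  using signoriniD(3)[OF u, of x] by (simp add: hess_inner laplacian_def)

text \<open>Both sides are the Hessian form at \<open>v\<close> and \<open>w\<close>, so equality of
  mixed partials suffices. It cancels the two second-order terms in
  \<open>rellich_identity\<close>.\<close>

lemma hess_symmetric:
  assumes x: "x \<in> upper_ball"
  shows "(\<Sum>b\<in>Basis. (hess b x \<bullet> v) * (w \<bullet> b)) = (\<Sum>b\<in>Basis. (hess b x \<bullet> w) * (v \<bullet> b))"
proof -
  have exp: "(\<Sum>b\<in>Basis. (hess b x \<bullet> v) * (w \<bullet> b)) =
     (\<Sum>b\<in>Basis. \<Sum>c\<in>Basis. pderiv_dir b (pderiv_dir c u) x * (v \<bullet> c) * (w \<bullet> b))" for v w
  proof (rule sum.cong[OF refl])
    fix b :: "(real ^ 'm) \<times> real"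
    show "(hess b x \<bullet> v) * (w \<bullet> b) = (\<Sum>c\<in>Basis. pderiv_dir b (pderiv_dir c u) x * (v \<bullet> c) * (w \<bullet> b))"
      by (simp add: euclidean_inner[of "hess b x" v] hess_inner sum_distrib_right)
  qed
  show ?thesis unfolding exp
    by (subst sum.swap) (intro sum.cong refl,
      simp add: mixed_partials_commute[OF signoriniD(2)[OF u] open_upper_ball x])
qed

lemma grad_inner_upper: "x \<in> upper_ball \<Longrightarrow> b \<in> Basis \<Longrightarrow> grad u x \<bullet> b = pderiv_dir b u x"
  by (simp add: grad_upper)

lemma u_deriv:
  assumes "x \<in> upper_ball" "b \<in> Basis"
  shows "((\<lambda>t. u (x + t *\<^sub>R b)) has_real_derivative grad u x \<bullet> b) (at 0)"
  unfolding grad_inner_upper[OF assms] by (rule has_real_derivative_along[OF signoriniD(7)[OF u assms(1)]])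

lemma grad_deriv:
  assumes x: "x \<in> upper_ball" and b: "b \<in> Basis"
  shows "((\<lambda>t. grad u (x + t *\<^sub>R b)) has_vector_derivative hess b x) (at 0)"
proof -
  have c: "((\<lambda>t. pderiv_dir c u (x + t *\<^sub>R b) *\<^sub>R c) has_vector_derivative pderiv_dir b (pderiv_dir c u) x *\<^sub>R c) (at 0)"
    if "c \<in> Basis" for c
    using has_vector_derivative_scaleR[OF has_real_derivative_along[OF signoriniD(8)[OF u that x], of b]
        has_vector_derivative_const[of c]] by simp
  have "((\<lambda>t. gradient u (x + t *\<^sub>R b)) has_vector_derivative hess b x) (at 0)"
    unfolding gradient_def hess_def by (intro has_vector_derivative_sum c)
  moreover have "\<forall>\<^sub>F t in nhds 0. t \<in> UNIV \<longrightarrow> gradient u (x + t *\<^sub>R b) = grad u (x + t *\<^sub>R b)"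
    using eventually_upper_along[OF x, of b] by eventually_elim (simp add: grad_upper)
  moreover have "gradient u (x + 0 *\<^sub>R b) = grad u (x + 0 *\<^sub>R b)" using x by (simp add: grad_upper)
  ultimately show ?thesis
    by (simp only: has_vector_derivative_cong_ev)
qed

text \<open>The divergence of the field is the squared norm of the gradient plus \<open>u\<close>
  times the Laplacian, which is 0; complementarity removes the normal component on the flat
  part.\<close>

lemma energy_identity:
  assumes r: "0 < r" "r < 1"
  shows "r * (LINT x:ball 0 r|lborel. (norm (grad u (fold_up x)))\<^sup>2) =
    (LINT x:sphere 0 r|sphere_measure r. fold_up x \<bullet> (u (fold_up x) *\<^sub>R grad u (fold_up x)))"
proof (rule folded_divergence_theorem[where D = "\<lambda>b x. (grad u x \<bullet> b)\<^sup>2 + u x * (hess b x \<bullet> b)"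
      and W = "\<lambda>x. u x *\<^sub>R grad u x" and f = "\<lambda>x. (norm (grad u x))\<^sup>2", OF _ _ _ _ _ _ r])
  fix b x :: "(real ^ 'm) \<times> real" assume b: "b \<in> Basis" and x: "x \<in> upper_ball"
  have "((\<lambda>t. grad u (x + t *\<^sub>R b) \<bullet> b) has_real_derivative hess b x \<bullet> b) (at 0)"
    using inner_deriv[OF grad_deriv[OF x b] has_vector_derivative_const[of b]] by simp
  from DERIV_mult[OF u_deriv[OF x b] this]
  show "((\<lambda>t. (u (x + t *\<^sub>R b) *\<^sub>R grad u (x + t *\<^sub>R b)) \<bullet> b) has_real_derivative
      (grad u x \<bullet> b)\<^sup>2 + u x * (hess b x \<bullet> b)) (at 0)"
    by (simp add: power2_eq_square add.commute mult.commute)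
next
  show "continuous_on upper_ball (\<lambda>x. (grad u x \<bullet> b)\<^sup>2 + u x * (hess b x \<bullet> b))" if "b \<in> Basis" for b
    using continuous_on_grad[OF u] signoriniD(1)[OF u] that
    by (intro continuous_intros hess_cont) (auto intro: continuous_on_subset)
  show "continuous_on (upper_ball \<union> flat_ball) (\<lambda>x. u x *\<^sub>R grad u x)"
    "continuous_on (upper_ball \<union> flat_ball) (\<lambda>x. (norm (grad u x))\<^sup>2)"
    by (intro continuous_intros continuous_on_grad[OF u] signoriniD(1)[OF u])+
  show "(norm (grad u x))\<^sup>2 = (\<Sum>b\<in>Basis. (grad u x \<bullet> b)\<^sup>2 + u x * (hess b x \<bullet> b))"
    if "x \<in> upper_ball" for x
  proof -
    have "(norm (grad u x))\<^sup>2 = (\<Sum>b\<in>Basis. (grad u x \<bullet> b) * (grad u x \<bullet> b))"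
      unfolding power2_norm_eq_inner by (rule euclidean_inner)
    then show ?thesis
      using sum_hess[OF that] by (simp add: sum.distrib sum_distrib_left[symmetric] power2_eq_square)
  qed
  show "snd (u x *\<^sub>R grad u x) = 0" if "x \<in> flat_ball" for x
    using signoriniD(5)[OF u that] by simp
qed

text \<open>The divergence is \<open>n |grad u|^2 + 2 Hess(grad u, x) - 2 Hess(x, grad u) - 2 |grad
  u|^2\<close> minus a multiple of the Laplacian. Symmetry and harmonicity leave
  \<open>(n - 2) |grad u|^2\<close>, which is continuous up to the flat part although the single
  terms need not be.\<close>

lemma rellich_identity:
  assumes r: "0 < r" "r < 1"
  shows "r * (LINT x:ball 0 r|lborel. (real DIM((real ^ 'm) \<times> real) - 2) * (norm (grad u (fold_up x)))\<^sup>2) =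
    (LINT x:sphere 0 r|sphere_measure r. fold_up x \<bullet> ((norm (grad u (fold_up x)))\<^sup>2 *\<^sub>R fold_up x
       - (2 * (fold_up x \<bullet> grad u (fold_up x))) *\<^sub>R grad u (fold_up x)))"
proof (rule folded_divergence_theorem[where
      D = "\<lambda>b x. (grad u x \<bullet> grad u x) + 2 * (hess b x \<bullet> grad u x) * (x \<bullet> b)
           - 2 * ((hess b x \<bullet> x) * (grad u x \<bullet> b) + (b \<bullet> grad u x) * (grad u x \<bullet> b) + (x \<bullet> grad u x) * (hess b x \<bullet> b))"
      and W = "\<lambda>x. (norm (grad u x))\<^sup>2 *\<^sub>R x - (2 * (x \<bullet> grad u x)) *\<^sub>R grad u x"
      and f = "\<lambda>x. (real DIM((real ^ 'm) \<times> real) - 2) * (norm (grad u x))\<^sup>2", OF _ _ _ _ _ _ r])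
  fix b x :: "(real ^ 'm) \<times> real" assume b: "b \<in> Basis" and x: "x \<in> upper_ball"
  note g = grad_deriv[OF x b] and l = line_deriv[of x b] and k = has_vector_derivative_const[of b]
  have 1: "((\<lambda>t. grad u (x + t *\<^sub>R b) \<bullet> b) has_real_derivative hess b x \<bullet> b) (at 0)"
    using inner_deriv[OF g k] by simp
  have 2: "((\<lambda>t. grad u (x + t *\<^sub>R b) \<bullet> grad u (x + t *\<^sub>R b)) has_real_derivative 2 * (hess b x \<bullet> grad u x)) (at 0)"
    using inner_deriv[OF g g] by (simp add: inner_commute)
  have 3: "((\<lambda>t. (x + t *\<^sub>R b) \<bullet> grad u (x + t *\<^sub>R b)) has_real_derivative (hess b x \<bullet> x) + b \<bullet> grad u x) (at 0)"
    using inner_deriv[OF l g] by (simp add: inner_commute)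
  have 4: "((\<lambda>t. (x + t *\<^sub>R b) \<bullet> b) has_real_derivative 1) (at 0)"
    using inner_deriv[OF l k] b by simp
  show "((\<lambda>t. ((norm (grad u (x + t *\<^sub>R b)))\<^sup>2 *\<^sub>R (x + t *\<^sub>R b)
        - (2 * ((x + t *\<^sub>R b) \<bullet> grad u (x + t *\<^sub>R b))) *\<^sub>R grad u (x + t *\<^sub>R b)) \<bullet> b) has_real_derivative
     (grad u x \<bullet> grad u x) + 2 * (hess b x \<bullet> grad u x) * (x \<bullet> b)
           - 2 * ((hess b x \<bullet> x) * (grad u x \<bullet> b) + (b \<bullet> grad u x) * (grad u x \<bullet> b) + (x \<bullet> grad u x) * (hess b x \<bullet> b))) (at 0)"
    unfolding inner_diff_left inner_scaleR_left power2_norm_eq_inner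
    by (rule DERIV_cong[OF DERIV_diff[OF DERIV_mult[OF 2 4] DERIV_mult[OF DERIV_cmult[OF 3, of 2] 1]]])
       (simp add: algebra_simps)
next
  show "continuous_on upper_ball (\<lambda>x. (grad u x \<bullet> grad u x) + 2 * (hess b x \<bullet> grad u x) * (x \<bullet> b)
           - 2 * ((hess b x \<bullet> x) * (grad u x \<bullet> b) + (b \<bullet> grad u x) * (grad u x \<bullet> b) + (x \<bullet> grad u x) * (hess b x \<bullet> b)))"
    if "b \<in> Basis" for b
    using continuous_on_grad[OF u] that
    by (intro continuous_intros hess_cont) (auto intro: continuous_on_subset)
  show "continuous_on (upper_ball \<union> flat_ball) (\<lambda>x. (norm (grad u x))\<^sup>2 *\<^sub>R x - (2 * (x \<bullet> grad u x)) *\<^sub>R grad u x)"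
    "continuous_on (upper_ball \<union> flat_ball) (\<lambda>x. (real DIM((real ^ 'm) \<times> real) - 2) * (norm (grad u x))\<^sup>2)"
    by (intro continuous_intros continuous_on_grad[OF u])+
  show "(real DIM((real ^ 'm) \<times> real) - 2) * (norm (grad u x))\<^sup>2 = (\<Sum>b\<in>Basis.
      (grad u x \<bullet> grad u x) + 2 * (hess b x \<bullet> grad u x) * (x \<bullet> b)
           - 2 * ((hess b x \<bullet> x) * (grad u x \<bullet> b) + (b \<bullet> grad u x) * (grad u x \<bullet> b) + (x \<bullet> grad u x) * (hess b x \<bullet> b)))"
    if x: "x \<in> upper_ball" for x
  proof -
    have gg: "(\<Sum>b\<in>Basis. (b \<bullet> grad u x) * (grad u x \<bullet> b)) = grad u x \<bullet> grad u x"
      unfolding euclidean_inner[of "grad u x" "grad u x"] by (simp add: inner_commute)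
    have "(\<Sum>b\<in>Basis. (grad u x \<bullet> grad u x) + 2 * (hess b x \<bullet> grad u x) * (x \<bullet> b)
           - 2 * ((hess b x \<bullet> x) * (grad u x \<bullet> b) + (b \<bullet> grad u x) * (grad u x \<bullet> b) + (x \<bullet> grad u x) * (hess b x \<bullet> b)))
      = real DIM((real ^ 'm) \<times> real) * (grad u x \<bullet> grad u x)
        + 2 * (\<Sum>b\<in>Basis. (hess b x \<bullet> grad u x) * (x \<bullet> b))
        - 2 * ((\<Sum>b\<in>Basis. (hess b x \<bullet> x) * (grad u x \<bullet> b)) + (\<Sum>b\<in>Basis. (b \<bullet> grad u x) * (grad u x \<bullet> b))
           + (x \<bullet> grad u x) * (\<Sum>b\<in>Basis. hess b x \<bullet> b))"
      by (simp only: sum.distrib sum_subtractf sum_distrib_left distrib_left sum_constant mult.assoc)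
    then show ?thesis
      unfolding gg sum_hess[OF x] hess_symmetric[OF x, of "grad u x" x]
      by (simp add: power2_norm_eq_inner algebra_simps)
  qed
  show "snd ((norm (grad u x))\<^sup>2 *\<^sub>R x - (2 * (x \<bullet> grad u x)) *\<^sub>R grad u x) = 0" if "x \<in> flat_ball" for x
    using radial_times_normal_derivative_eq_0[OF u that] that by (simp add: flat_ball_def)
qed

text \<open>The sphere term is \<open>r\<^sup>2\<close> times the integral of
  \<open>u\<^sup>2\<close>. Read backwards, this expresses the sphere integral in the Weiss energy
  by a ball integral, whose derivative in the radius is known.\<close>

lemma square_identity:
  assumes r: "0 < r" "r < 1"
  shows "r * (LINT x:ball 0 r|lborel. 2 * (u (fold_up x) * (fold_up x \<bullet> grad u (fold_up x))) + real DIM((real ^ 'm) \<times> real) * (u (fold_up x))\<^sup>2) =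
    (LINT x:sphere 0 r|sphere_measure r. fold_up x \<bullet> ((u (fold_up x))\<^sup>2 *\<^sub>R fold_up x))"
proof (rule folded_divergence_theorem[where D = "\<lambda>b x. 2 * u x * (grad u x \<bullet> b) * (x \<bullet> b) + (u x)\<^sup>2"
      and W = "\<lambda>x. (u x)\<^sup>2 *\<^sub>R x"
      and f = "\<lambda>x. 2 * (u x * (x \<bullet> grad u x)) + real DIM((real ^ 'm) \<times> real) * (u x)\<^sup>2", OF _ _ _ _ _ _ r])
  fix b x :: "(real ^ 'm) \<times> real" assume b: "b \<in> Basis" and x: "x \<in> upper_ball"
  have 4: "((\<lambda>t. (x + t *\<^sub>R b) \<bullet> b) has_real_derivative 1) (at 0)"
    using inner_deriv[OF line_deriv[of x b] has_vector_derivative_const[of b]] b by simp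
  show "((\<lambda>t. ((u (x + t *\<^sub>R b))\<^sup>2 *\<^sub>R (x + t *\<^sub>R b)) \<bullet> b) has_real_derivative
     2 * u x * (grad u x \<bullet> b) * (x \<bullet> b) + (u x)\<^sup>2) (at 0)"
    unfolding inner_scaleR_left
    by (rule DERIV_cong[OF DERIV_mult[OF DERIV_power[OF u_deriv[OF x b], of 2] 4]]) (simp add: algebra_simps)
next
  show "continuous_on upper_ball (\<lambda>x. 2 * u x * (grad u x \<bullet> b) * (x \<bullet> b) + (u x)\<^sup>2)" for b
    using continuous_on_grad[OF u] signoriniD(1)[OF u]
    by (intro continuous_intros) (auto intro: continuous_on_subset)
  show "continuous_on (upper_ball \<union> flat_ball) (\<lambda>x. (u x)\<^sup>2 *\<^sub>R x)"
    "continuous_on (upper_ball \<union> flat_ball) (\<lambda>x. 2 * (u x * (x \<bullet> grad u x)) + real DIM((real ^ 'm) \<times> real) * (u x)\<^sup>2)"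
    by (intro continuous_intros continuous_on_grad[OF u] signoriniD(1)[OF u])+
  show "2 * (u x * (x \<bullet> grad u x)) + real DIM((real ^ 'm) \<times> real) * (u x)\<^sup>2 =
     (\<Sum>b\<in>Basis. 2 * u x * (grad u x \<bullet> b) * (x \<bullet> b) + (u x)\<^sup>2)" for x
    unfolding euclidean_inner[of x "grad u x"]
    by (simp add: sum.distrib sum_distrib_left mult_ac)
  show "snd ((u x)\<^sup>2 *\<^sub>R x) = 0" if "x \<in> flat_ball" for x
    using that by (simp add: flat_ball_def)
qed

end

section \<open>The Weiss energy\<close>

text \<open>The ball integral has derivative 0, so it is constant, and the constant is 0 because
  small balls have small volume. A nonnegative continuous function with integral 0 vanishes. Passing
  to balls avoids null sets on single spheres.\<close>

lemma sphere_integrals_zero_imp_zero: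
  fixes g :: "'a::euclidean_space \<Rightarrow> real"
  assumes g: "continuous_on (ball 0 1) g" and nonneg: "\<And>x. x \<in> ball 0 1 \<Longrightarrow> g x \<ge> 0"
    and zero: "\<And>r. 0 < r \<Longrightarrow> r < 1 \<Longrightarrow> (LINT x:sphere 0 r|sphere_measure r. g x) = 0"
    and x: "x \<in> ball 0 1"
  shows "g x = 0"
proof -
  define Q where "Q = (\<lambda>s. LINT x:ball 0 s|lborel. g x)"
  have "(Q has_real_derivative 0) (at r)" if "r \<in> {0<..<1}" for r
    using has_real_derivative_ball_integral[OF g, of r] zero[of r] that by (simp add: Q_def)
  then have "\<exists>c. \<forall>r\<in>{0<..<1}. Q r = c"
    by (intro has_field_derivative_zero_constant) (auto intro: has_field_derivative_at_within)
  then obtain c where c: "\<And>r. 0 < r \<Longrightarrow> r < 1 \<Longrightarrow> Q r = c" by auto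
  have "cball (0::'a) (1/2) \<subseteq> ball 0 1" by auto
  then have "continuous_on (cball 0 (1/2)) g" by (rule continuous_on_subset[OF g])
  then have "bounded (g ` cball 0 (1/2))"
    using compact_continuous_image compact_imp_bounded compact_cball by blast
  then obtain M where M: "M > 0" "\<And>x. x \<in> cball 0 (1/2) \<Longrightarrow> \<bar>g x\<bar> \<le> M"
    unfolding bounded_pos by auto
  define V where "V = measure lborel (ball (0::'a) 1)"
  have V: "V \<ge> 0" unfolding V_def by (rule measure_nonneg)
  \<comment> \<open>Constancy holds on the open interval of radii, so the value 0 is reached as
    \<open>s\<close> tends to 0; \<open>s ^ n \<le> s\<close> for \<open>s < 1\<close> makes the
    bound linear.\<close>
  have "\<bar>c\<bar> \<le> M * V * s" if s: "0 < s" "s < 1/2" for s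
  proof -
    have "\<bar>Q s - Q 0\<bar> \<le> M * (measure lborel (ball (0::'a) s) - measure lborel (ball (0::'a) 0))"
      unfolding Q_def using s M by (intro set_integral_ball_diff_le set_integrable_ball[OF g]) auto
    also have "\<dots> = M * (s ^ DIM('a) * V)"
      using measure_ball_power[OF s(1), where 'a = 'a] by (simp add: V_def)
    also have "\<dots> \<le> M * (s * V)"
      using s M V DIM_positive[where 'a = 'a] power_decreasing[of 1 "DIM('a)" s]
      by (intro mult_left_mono mult_right_mono) (auto simp: Suc_le_eq)
    finally show ?thesis using c[of s] s by (simp add: Q_def set_lebesgue_integral_def mult_ac)
  qed
  then have "\<forall>\<^sub>F s in at_right 0. \<bar>c\<bar> \<le> M * V * s"
    using eventually_at_right_real[of 0 "1/2"] by (auto elim!: eventually_mono)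
  moreover have "((\<lambda>s. M * V * s) \<longlongrightarrow> M * V * 0) (at_right 0)"
    by (intro tendsto_intros)
  ultimately have "\<bar>c\<bar> \<le> M * V * 0"
    by (intro tendsto_lowerbound) auto
  then have "c = 0" by simp
  define s where "s = (1 + norm x) / 2"
  have s: "norm x < s" "s < 1" "0 < s" using x norm_ge_zero[of x] by (auto simp: s_def add_pos_nonneg)
  have int: "integrable lborel (\<lambda>x. indicator (ball 0 s) x *\<^sub>R g x)"
    using set_integrable_ball[OF g s(2)] by (simp add: set_integrable_def)
  moreover have "(\<integral>x. indicator (ball 0 s) x *\<^sub>R g x \<partial>lborel) = 0"
    using c[OF s(3,2)] \<open>c = 0\<close> by (simp add: Q_def set_lebesgue_integral_def)
  ultimately have AE: "AE x in lborel. indicator (ball 0 s) x *\<^sub>R g x = 0"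
    using nonneg s by (subst (asm) integral_nonneg_eq_0_iff_AE) (auto simp: indicator_def)
  define T where "T = ball 0 s \<inter> g -` {0<..}"
  have T: "open T" unfolding T_def
    by (intro continuous_open_preimage continuous_on_subset[OF g]) (use s in auto)
  have "AE x in lborel. x \<notin> T"
    using AE by eventually_elim (auto simp: T_def)
  then have "T \<in> null_sets lborel" using T by (subst AE_iff_null_sets) auto
  then have "negligible T" by (simp add: negligible_iff_null_sets null_sets_completionI)
  then have "T = {}" using open_not_negligible[OF T] by auto
  then have "x \<notin> T" by simp
  then have "g x \<le> 0" using s by (auto simp: T_def)
  then show ?thesis using nonneg[OF x] by simp
qed

section \<open>Differentiating the Weiss energy\<close>

context
  fixes u :: "(real ^ 'm::finite) \<times> real \<Rightarrow> real"
  assumes u: "u \<in> signorini"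
begin

lemma continuous_on_ball_u: "continuous_on (ball 0 1) u"
  by (rule continuous_on_eq[OF continuous_on_fold_up[OF signoriniD(1)[OF u]]])
     (simp add: fold_up_invariance[OF u])

lemma continuous_on_ball_radial: "continuous_on (ball 0 1) (\<lambda>x. x \<bullet> grad u x)"
proof -
  have "continuous_on (upper_ball \<union> flat_ball) (\<lambda>x. x \<bullet> grad u x)"
    by (intro continuous_intros continuous_on_grad[OF u])
  from continuous_on_eq[OF continuous_on_fold_up[OF this]] show ?thesis
    by (simp add: fold_up_invariance[OF u])
qed

lemma continuous_on_ball_grad_norm: "continuous_on (ball 0 1) (\<lambda>x. (norm (grad u x))\<^sup>2)"
proof -
  have "continuous_on (upper_ball \<union> flat_ball) (\<lambda>x. (norm (grad u x))\<^sup>2)"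
    by (intro continuous_intros continuous_on_grad[OF u])
  from continuous_on_eq[OF continuous_on_fold_up[OF this]] show ?thesis
    by (simp add: fold_up_invariance[OF u])
qed

lemma weiss_has_derivative:
  assumes r: "0 < r" "r < 1"
  shows "((\<lambda>r. weiss \<kappa> r u) has_real_derivative
               2 / r powr (real DIM((real ^ 'm) \<times> real) + 2 * \<kappa>) *
               (LINT x:sphere 0 r|sphere_measure r. (x \<bullet> grad u x - \<kappa> * u x)\<^sup>2)) (at r)"
proof -
  define N where "N = real DIM((real ^ 'm) \<times> real)"
  define e where "e = (\<lambda>x. u x * (x \<bullet> grad u x))"
  define S where "S = (\<lambda>s (f :: (real ^ 'm) \<times> real \<Rightarrow> real). LINT x:sphere 0 s|sphere_measure s. f x)"
  define B where "B = (\<lambda>s (f :: (real ^ 'm) \<times> real \<Rightarrow> real). LINT x:ball 0 s|lborel. f x)"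
  have BE: "(LINT x:ball 0 s|lborel. f x) = B s f" and SE: "(LINT x:sphere 0 s|sphere_measure s. f x) = S s f"
    for s f by (simp_all add: B_def S_def)
  let ?g = "\<lambda>x. (norm (grad u x))\<^sup>2" and ?u2 = "\<lambda>x. (u x)\<^sup>2" and ?m = "\<lambda>x. (x \<bullet> grad u x)\<^sup>2"
  \<comment> \<open>On the upper half this is the divergence of \<open>u\<^sup>2 x\<close>, so
    \<open>B s z\<close> is \<open>s\<close> times the sphere integral of
    \<open>u\<^sup>2\<close>.\<close>
  define z where "z = (\<lambda>x. 2 * e x + N * ?u2 x)"
  note cont = continuous_on_ball_u continuous_on_ball_radial continuous_on_ball_grad_norm
  have e_cont: "continuous_on (ball 0 1) e" unfolding e_def by (intro continuous_intros cont)
  have m_cont: "continuous_on (ball 0 1) ?m" by (rule continuous_on_power[OF cont(2)])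
  have u2_cont: "continuous_on (ball 0 1) ?u2" by (rule continuous_on_power[OF cont(1)])
  have z_cont: "continuous_on (ball 0 1) z" unfolding z_def by (intro continuous_intros cont e_cont)
  have S_int: "set_integrable (sphere_measure s) (sphere 0 s) f"
    if "continuous_on (ball 0 1) f" "s < 1" for f :: "(real ^ 'm) \<times> real \<Rightarrow> real" and s
    by (rule set_integrable_sphere[OF continuous_on_subset[OF that(1)]]) (use that(2) in auto)
  have S_lin: "S s (\<lambda>x. a * f x + b * g x) = a * S s f + b * S s g"
    if "continuous_on (ball 0 1) f" "continuous_on (ball 0 1) g" "s < 1"
    for f g :: "(real ^ 'm) \<times> real \<Rightarrow> real" and s a b
    unfolding S_def using S_int[OF that(1,3)] S_int[OF that(2,3)]
    by (subst set_integral_add(2)) auto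
  have S_cong: "S s f = S s g" if "\<And>x. norm x = s \<Longrightarrow> f x = g x"
    for f g :: "(real ^ 'm) \<times> real \<Rightarrow> real" and s
    using sphere_integral_mult[of s f 1 g] that by (simp add: S_def)
  have B_cong: "B s f = B s g" if "\<And>x. norm x < s \<Longrightarrow> f x = g x" for f g s
    unfolding B_def using that by (intro set_lebesgue_integral_cong) auto
  have energy: "r * B r ?g = S r e"
    using energy_identity[OF u r] r
      B_cong[of r "\<lambda>x. (norm (grad u (fold_up x)))\<^sup>2" ?g]
      S_cong[of r "\<lambda>x. fold_up x \<bullet> (u (fold_up x) *\<^sub>R grad u (fold_up x))" e]
    by (simp add: fold_up_invariance[OF u] e_def BE SE)
  have rellich: "r * ((N - 2) * B r ?g) = r\<^sup>2 * S r ?g - 2 * S r ?m"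
  proof -
    have "S r (\<lambda>x. fold_up x \<bullet> ((norm (grad u (fold_up x)))\<^sup>2 *\<^sub>R fold_up x
       - (2 * (fold_up x \<bullet> grad u (fold_up x))) *\<^sub>R grad u (fold_up x))) = S r (\<lambda>x. r\<^sup>2 * ?g x + (- 2) * ?m x)"
      using r by (intro S_cong)
        (simp add: fold_up_invariance[OF u] inner_diff_right dot_square_norm power2_eq_square)
    also have "\<dots> = r\<^sup>2 * S r ?g + (- 2) * S r ?m"
      by (rule S_lin[OF cont(3) m_cont r(2)])
    moreover have "B r (\<lambda>x. (N - 2) * (norm (grad u (fold_up x)))\<^sup>2) = B r (\<lambda>x. (N - 2) * ?g x)"
      using r by (intro B_cong) (simp add: fold_up_invariance[OF u])
    moreover have "B r (\<lambda>x. (N - 2) * ?g x) = (N - 2) * B r ?g" by (simp add: B_def)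
    moreover have "r * B r (\<lambda>x. (N - 2) * (norm (grad u (fold_up x)))\<^sup>2) =
      S r (\<lambda>x. fold_up x \<bullet> ((norm (grad u (fold_up x)))\<^sup>2 *\<^sub>R fold_up x
       - (2 * (fold_up x \<bullet> grad u (fold_up x))) *\<^sub>R grad u (fold_up x)))"
      using rellich_identity[OF u r] unfolding N_def BE SE .
    ultimately show ?thesis by simp
  qed
  have square: "B s z = s * S s ?u2" if s: "0 < s" "s < 1" for s
  proof -
    have "S s (\<lambda>x. fold_up x \<bullet> ((u (fold_up x))\<^sup>2 *\<^sub>R fold_up x)) = S s (\<lambda>x. s\<^sup>2 * ?u2 x)"
      using s by (intro S_cong) (simp add: fold_up_invariance[OF u] dot_square_norm)
    moreover have "S s (\<lambda>x. s\<^sup>2 * ?u2 x) = s * (s * S s ?u2)" by (simp add: S_def power2_eq_square)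
    moreover have "B s (\<lambda>x. 2 * (u (fold_up x) * (fold_up x \<bullet> grad u (fold_up x))) + N * (u (fold_up x))\<^sup>2) = B s z"
      using s by (intro B_cong) (simp add: fold_up_invariance[OF u] z_def e_def)
    ultimately have "s * B s z = s * (s * S s ?u2)"
      using square_identity[OF u s] by (simp add: N_def BE SE)
    then show ?thesis using s by simp
  qed
  \<comment> \<open>Replacing the sphere integral by \<open>B s z / s\<close> raises the exponent
    from \<open>N - 1 + 2 * \<kappa>\<close> to \<open>N + 2 * \<kappa>\<close>; both terms are now
    powers times ball integrals of continuous functions.\<close>
  have W: "weiss \<kappa> s u = s powr (- (N - 2 + 2 * \<kappa>)) * B s ?g - \<kappa> * s powr (- (N + 2 * \<kappa>)) * B s z"
    if s: "0 < s" "s < 1" for s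
  proof -
    have "s powr (- (N + 2 * \<kappa>)) * s = s powr (- (N + 2 * \<kappa>)) * s powr 1" using s by simp
    also have "\<dots> = s powr (- (N - 1 + 2 * \<kappa>))" unfolding powr_add[symmetric] by (simp add: algebra_simps)
    finally have "inverse (s powr (N - 1 + 2 * \<kappa>)) = inverse (s powr (N + 2 * \<kappa>)) * s"
      unfolding powr_minus by simp
    then show ?thesis
      unfolding square[OF s] weiss_def Let_def N_def[symmetric] BE SE divide_inverse powr_minus
      by (simp only: mult.assoc mult_1_left)
  qed
  \<comment> \<open>Common factor of all terms of the derivative; the other powers of
    \<open>r\<close> that occur are \<open>P\<close> times \<open>r\<^sup>2\<close>,
    \<open>r\<close> and \<open>1 / r\<close>.\<close>
  define P where "P = r powr (- (N + 2 * \<kappa>))"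
  have P2: "r powr (- (N - 2 + 2 * \<kappa>)) = r\<^sup>2 * P"
    using r powr_add[of r 2 "- (N + 2 * \<kappa>)"] by (simp add: P_def algebra_simps)
  have P1: "r powr (- (N - 2 + 2 * \<kappa>) - 1) = r * P"
    using r powr_add[of r 1 "- (N + 2 * \<kappa>)"] by (simp add: P_def algebra_simps)
  have P0: "r powr (- (N + 2 * \<kappa>) - 1) = P / r"
    using r by (simp add: P_def powr_diff)
  have dB: "((\<lambda>s. B s ?g) has_real_derivative S r ?g) (at r)" "((\<lambda>s. B s z) has_real_derivative S r z) (at r)"
    unfolding B_def S_def by (intro has_real_derivative_ball_integral[OF _ r] cont z_cont)+
  have Sz: "S r z = 2 * S r e + N * S r ?u2"
    unfolding z_def by (rule S_lin[OF e_cont u2_cont r(2)])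
  have Sq: "S r (\<lambda>x. (x \<bullet> grad u x - \<kappa> * u x)\<^sup>2) = S r ?m - 2 * \<kappa> * S r e + \<kappa>\<^sup>2 * S r ?u2"
  proof -
    have me_cont: "continuous_on (ball 0 1) (\<lambda>x. 1 * ?m x + (- 2 * \<kappa>) * e x)"
      by (intro continuous_on_add continuous_on_mult continuous_on_const m_cont e_cont)
    have "S r (\<lambda>x. (x \<bullet> grad u x - \<kappa> * u x)\<^sup>2) = S r (\<lambda>x. 1 * (1 * ?m x + (- 2 * \<kappa>) * e x) + \<kappa>\<^sup>2 * ?u2 x)"
      by (rule S_cong) (simp add: e_def power2_eq_square algebra_simps)
    also have "\<dots> = 1 * (1 * S r ?m + (- 2 * \<kappa>) * S r e) + \<kappa>\<^sup>2 * S r ?u2"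
      by (simp only: S_lin[OF me_cont u2_cont r(2)] S_lin[OF m_cont e_cont r(2)])
    finally show ?thesis by simp
  qed
  have rZ: "B r z / r = S r ?u2" using square[OF r] r by simp
  have dp: "((\<lambda>s. s powr a) has_real_derivative a * r powr (a - 1)) (at r)" for a
    by (rule has_real_derivative_powr[OF r(1)])
  have t1: "((\<lambda>s. s powr (- (N - 2 + 2 * \<kappa>)) * B s ?g) has_real_derivative
      - (N - 2 + 2 * \<kappa>) * (r * P) * B r ?g + S r ?g * (r\<^sup>2 * P)) (at r)"
    using DERIV_mult[OF dp[of "- (N - 2 + 2 * \<kappa>)"] dB(1)] unfolding P1 P2 .
  have "((\<lambda>s. \<kappa> * s powr (- (N + 2 * \<kappa>))) has_real_derivative \<kappa> * (- (N + 2 * \<kappa>) * (P / r))) (at r)"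
    using DERIV_cmult[OF dp[of "- (N + 2 * \<kappa>)"], of \<kappa>] unfolding P0 .
  from DERIV_mult[OF this dB(2)]
  have t2: "((\<lambda>s. \<kappa> * s powr (- (N + 2 * \<kappa>)) * B s z) has_real_derivative
      \<kappa> * (- (N + 2 * \<kappa>) * (P / r)) * B r z + S r z * (\<kappa> * P)) (at r)"
    unfolding P_def[symmetric] .
  note DERIV_diff[OF t1 t2]
  \<comment> \<open>\<open>rellich\<close> cancels the terms in \<open>S r ?g\<close> and leaves
    \<open>2 * S r ?m\<close>; \<open>energy\<close> and \<open>Sz\<close> each give
    \<open>- 2 * \<kappa> * S r e\<close>; the multiples of \<open>N\<close> cancel, leaving
    \<open>2 * \<kappa>\<^sup>2 * S r ?u2\<close>. This is twice the expanded square.\<close>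
  moreover have "(- (N - 2 + 2 * \<kappa>) * (r * P) * B r ?g + S r ?g * (r\<^sup>2 * P))
      - (\<kappa> * (- (N + 2 * \<kappa>) * (P / r)) * B r z + S r z * (\<kappa> * P))
     = 2 * P * S r (\<lambda>x. (x \<bullet> grad u x - \<kappa> * u x)\<^sup>2)"
  proof -
    have "(- (N - 2 + 2 * \<kappa>) * (r * P) * B r ?g + S r ?g * (r\<^sup>2 * P))
      - (\<kappa> * (- (N + 2 * \<kappa>) * (P / r)) * B r z + S r z * (\<kappa> * P))
      = P * (- (r * ((N - 2) * B r ?g)) - 2 * \<kappa> * (r * B r ?g) + r\<^sup>2 * S r ?g
          + \<kappa> * (N + 2 * \<kappa>) * (B r z / r) - \<kappa> * S r z)"
      by (simp add: algebra_simps)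
    also have "\<dots> = 2 * P * S r (\<lambda>x. (x \<bullet> grad u x - \<kappa> * u x)\<^sup>2)"
      unfolding rellich energy rZ Sz Sq by (simp add: algebra_simps power2_eq_square)
    finally show ?thesis .
  qed
  ultimately have "((\<lambda>s. s powr (- (N - 2 + 2 * \<kappa>)) * B s ?g - \<kappa> * s powr (- (N + 2 * \<kappa>)) * B s z) has_real_derivative
     2 * P * S r (\<lambda>x. (x \<bullet> grad u x - \<kappa> * u x)\<^sup>2)) (at r)" by simp
  then have "((\<lambda>s. weiss \<kappa> s u) has_real_derivative 2 * P * S r (\<lambda>x. (x \<bullet> grad u x - \<kappa> * u x)\<^sup>2)) (at r)"
    by (rule has_field_derivative_transform_within_open[of _ _ _ "{0<..<1}"]) (use r W in auto)
  moreover have "2 * P = 2 / r powr (N + 2 * \<kappa>)" unfolding P_def powr_minus_divide by simp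
  ultimately show ?thesis unfolding N_def[symmetric] SE by simp
qed

end

theorem theorem1p4p1:
  fixes u :: "(real ^ 'm) \<times> real \<Rightarrow> real" and \<kappa> :: real and n :: nat
  assumes "n = DIM((real ^ 'm) \<times> real)"
    and "u \<in> signorini"
    and "\<kappa> \<ge> 0"
  shows "(\<forall>r. 0 < r \<and> r < 1 \<longrightarrow>
            ((\<lambda>r. weiss \<kappa> r u) has_real_derivative
               2 / r powr (real n + 2 * \<kappa>) *
               (LINT x:sphere 0 r|sphere_measure r. (x \<bullet> grad u x - \<kappa> * u x)\<^sup>2)) (at r))
       \<and> mono_on {0<..<1} (\<lambda>r. weiss \<kappa> r u)
       \<and> ((\<lambda>r. weiss \<kappa> r u) constant_on {0<..<1} \<longleftrightarrow> homogeneous \<kappa> u)"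
proof -
  note u = assms(2)
  let ?W = "\<lambda>r. weiss \<kappa> r u" and ?q = "\<lambda>x. (x \<bullet> grad u x - \<kappa> * u x)\<^sup>2"
  define d where "d = (\<lambda>r. 2 / r powr (real n + 2 * \<kappa>) * (LINT x:sphere 0 r|sphere_measure r. ?q x))"
  have der: "(?W has_real_derivative d r) (at r)" if "0 < r" "r < 1" for r
    unfolding d_def assms(1) by (rule weiss_has_derivative[OF u that])
  have d_nonneg: "d r \<ge> 0" for r
    unfolding d_def set_lebesgue_integral_def
    by (intro mult_nonneg_nonneg divide_nonneg_nonneg Bochner_Integration.integral_nonneg) auto
  have "mono_on {0<..<1} ?W"
  proof (rule mono_onI)
    fix r s :: real assume rs: "r \<in> {0<..<1}" "s \<in> {0<..<1}" "r \<le> s"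
    have "\<exists>y. (?W has_real_derivative y) (at t) \<and> 0 \<le> y" if "r \<le> t" "t \<le> s" for t
      using der[of t] d_nonneg[of t] rs that by auto
    then show "?W r \<le> ?W s" by (rule DERIV_nonneg_imp_nondecreasing[OF rs(3)])
  qed
  moreover have "homogeneous \<kappa> u" if "?W constant_on {0<..<1}"
  proof -
    from that obtain c where c: "\<forall>r\<in>{0<..<1}. ?W r = c"
      unfolding constant_on_def by (elim exE)
    have q_cont: "continuous_on (ball 0 1) ?q"
      by (intro continuous_on_power continuous_on_diff continuous_on_mult continuous_on_const
          continuous_on_ball_radial[OF u] continuous_on_ball_u[OF u])
    \<comment> \<open>The prefactor in \<open>d r\<close> is positive, so a vanishing derivative
      forces the sphere integral to vanish; continuity of \<open>?q\<close> on the whole ball, flat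
      part included, then gives the pointwise statement.\<close>
    have "(LINT x:sphere 0 r|sphere_measure r. ?q x) = 0" if r: "0 < r" "r < 1" for r
    proof -
      have "(?W has_real_derivative 0) (at r)"
        by (rule has_field_derivative_transform_within_open[of "\<lambda>_. c" _ _ "{0<..<1}"]) (use r c in auto)
      then have "d r = 0" using der[OF r] DERIV_unique by blast
      then show ?thesis using r by (simp add: d_def)
    qed
    then have "?q x = 0" if "x \<in> ball 0 1" for x
      using sphere_integrals_zero_imp_zero[OF q_cont _ _ that] by simp
    then show ?thesis by (simp add: homogeneous_def)
  qed
  moreover have "?W constant_on {0<..<1}" if hom: "homogeneous \<kappa> u"
  proof -
    have "d r = 0" if "0 < r" "r < 1" for r
      using sphere_integral_mult[of r ?q 0 "\<lambda>_. 0" "sphere_measure r"] hom that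
      by (simp add: d_def homogeneous_def)
    then have "(?W has_real_derivative 0) (at r within {0<..<1})" if "r \<in> {0<..<1}" for r
      using der[of r] that by (simp add: has_field_derivative_at_within)
    then have "\<exists>c. \<forall>r\<in>{0<..<1}. ?W r = c"
      by (intro has_field_derivative_zero_constant) auto
    then show ?thesis by (simp add: constant_on_def)
  qed
  ultimately show ?thesis using der by (auto simp: d_def)
qed

end
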